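(* Let $A,B,C$ be algebras and $R_1:B\otimes A\to A\otimes B$, $R_2:C\otimes B\to B\otimes C$, $R_3:C\otimes A\to A\otimes C$ be unital twisting maps that satisfy the hexagon equation $$(A\otimes R_2)\circ(R_3\otimes B)\circ(C\otimes R_1)=(R_1\otimes C)\circ(B\otimes R_3)\circ(R_2\otimes A).$$ Let $X$ be an algebra and let $u:A\to X$, $v:B\to X$, $w:C\to X$ be algebra morphisms such that $$\mu_X\circ(w\otimes v\otimes u)=\mu_X\circ(u\otimes v\otimes w)\circ(A\otimes R_2)\circ(R_3\otimes B)\circ(C\otimes R_1),$$ where $\mu_X$ here denotes the threefold product $X\otimes X\otimes X\to X$. Then there exists a unique algebra map $\varphi:A\otimes_{R_1}B\otimes_{R_2}C\to X$ such that $\varphi\circ i_A=u$, $\varphi\circ i_B=v$ and $\varphi\circ i_C=w$.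
   Context: Fix a field or commutative ring $k$; $\otimes=\otimes_k$; algebras are associative unital $k$-algebras, algebra morphisms preserve units, and $\mu_A$ denotes the product of $A$. An object also denotes its identity map. A twisting map for algebras $A,B$ is a $k$-linear map $R:B\otimes A\to A\otimes B$ with $$R\circ(B\otimes\mu_A)=(\mu_A\otimes B)\circ(A\otimes R)\circ(R\otimes A),\qquad R\circ(\mu_B\otimes A)=(A\otimes\mu_B)\circ(R\otimes B)\circ(B\otimes R).$$ Then $A\otimes_R B$ denotes $A\otimes B$ with the associative product $\mu_R:=(\mu_A\otimes\mu_B)\circ(A\otimes R\otimes B)$. $R$ is unital if $R(1\otimes a)=a\otimes 1$ and $R(b\otimes 1)=1\otimes b$ for all $a,b$. When the hexagon equation holds, $T_1:=(A\otimes R_2)\circ(R_3\otimes B):C\otimes(A\otimes_{R_1}B)\to(A\otimes_{R_1}B)\otimes C$ and $T_2:=(R_1\otimes C)\circ(B\otimes R_3):(B\otimes_{R_2}C)\otimes A\to A\otimes(B\otimes_{R_2}C)$ are twisting maps, and $A\otimes_{R_1}B\otimes_{R_2}C$ denotes the algebra $(A\otimes_{R_1}B)\otimes_{T_1}C=A\otimes_{T_2}(B\otimes_{R_2}C)$. The canonical inclusions are $i_A(a)=a\otimes1\otimes1$, $i_B(b)=1\otimes b\otimes1$, $i_C(c)=1\otimes1\otimes c$. *)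

theory Defs
  imports "HOL.Hull" "HOL-Algebra.Module" "HOL-Algebra.QuotRing"
begin

section \<open>Algebras over a commutative ring and their morphisms\<close>

text \<open>The locale \<^locale>\<open>algebra\<close> of HOL-Algebra only covers commutative algebras, so the
  associative unital ones are introduced here.\<close>

locale assoc_algebra = module K A + ring A for K (structure) and A (structure) +
  assumes smult_mult_left:
      "\<lbrakk>r \<in> carrier K; x \<in> carrier A; y \<in> carrier A\<rbrakk> \<Longrightarrow>
        (r \<odot>\<^bsub>A\<^esub> x) \<otimes>\<^bsub>A\<^esub> y = r \<odot>\<^bsub>A\<^esub> (x \<otimes>\<^bsub>A\<^esub> y)"
    and smult_mult_right:
      "\<lbrakk>r \<in> carrier K; x \<in> carrier A; y \<in> carrier A\<rbrakk> \<Longrightarrow>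
        x \<otimes>\<^bsub>A\<^esub> (r \<odot>\<^bsub>A\<^esub> y) = r \<odot>\<^bsub>A\<^esub> (x \<otimes>\<^bsub>A\<^esub> y)"

definition linear_maps ::
  "('k, 'c) ring_scheme \<Rightarrow> ('k, 'm, 'd) module_scheme \<Rightarrow> ('k, 'n, 'e) module_scheme \<Rightarrow> ('m \<Rightarrow> 'n) set"
  where "linear_maps K M N =
    {f. f \<in> carrier M \<rightarrow> carrier N \<and>
        (\<forall>x\<in>carrier M. \<forall>y\<in>carrier M. f (x \<oplus>\<^bsub>M\<^esub> y) = f x \<oplus>\<^bsub>N\<^esub> f y) \<and>
        (\<forall>r\<in>carrier K. \<forall>x\<in>carrier M. f (r \<odot>\<^bsub>M\<^esub> x) = r \<odot>\<^bsub>N\<^esub> f x)}"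

definition algebra_homs ::
  "('k, 'c) ring_scheme \<Rightarrow> ('k, 'm, 'd) module_scheme \<Rightarrow> ('k, 'n, 'e) module_scheme \<Rightarrow> ('m \<Rightarrow> 'n) set"
  where "algebra_homs K A B = ring_hom A B \<inter> linear_maps K A B"


section \<open>Tensor products of modules\<close>

text \<open>Module records extend ring records; for objects that are merely modules the
  fields \<^const>\<open>mult\<close> and \<^const>\<open>one\<close> carry no information and are left undefined.\<close>

definition free_module :: "('k, 'c) ring_scheme \<Rightarrow> 's set \<Rightarrow> ('k, 's \<Rightarrow> 'k) module"
  where "free_module K S =
    \<lparr>carrier = {f. (\<forall>s\<in>S. f s \<in> carrier K) \<and> (\<forall>s. s \<notin> S \<longrightarrow> f s = \<zero>\<^bsub>K\<^esub>)
                   \<and> finite {s. f s \<noteq> \<zero>\<^bsub>K\<^esub>}},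
     mult = undefined, one = undefined,
     zero = (\<lambda>s. \<zero>\<^bsub>K\<^esub>),
     add = (\<lambda>f g s. f s \<oplus>\<^bsub>K\<^esub> g s),
     smult = (\<lambda>r f s. r \<otimes>\<^bsub>K\<^esub> f s)\<rparr>"

definition free_gen :: "('k, 'c) ring_scheme \<Rightarrow> 's \<Rightarrow> ('s \<Rightarrow> 'k)"
  where "free_gen K s = (\<lambda>t. if t = s then \<one>\<^bsub>K\<^esub> else \<zero>\<^bsub>K\<^esub>)"

definition quot_module ::
  "('k, 'c) ring_scheme \<Rightarrow> ('k, 'm, 'd) module_scheme \<Rightarrow> 'm set \<Rightarrow> ('k, 'm set) module"
  where "quot_module K M N =
    \<lparr>carrier = a_rcosets\<^bsub>M\<^esub> N,
     mult = undefined, one = undefined,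
     zero = N,
     add = set_add M,
     smult = (\<lambda>r X. \<Union>x\<in>X. N +>\<^bsub>M\<^esub> (r \<odot>\<^bsub>M\<^esub> x))\<rparr>"

definition tensor_free ::
  "('k, 'c) ring_scheme \<Rightarrow> ('k, 'a, 'd) module_scheme \<Rightarrow> ('k, 'b, 'e) module_scheme \<Rightarrow>
    ('k, 'a \<times> 'b \<Rightarrow> 'k) module"
  where "tensor_free K A B = free_module K (carrier A \<times> carrier B)"

definition tensor_relators ::
  "('k, 'c) ring_scheme \<Rightarrow> ('k, 'a, 'd) module_scheme \<Rightarrow> ('k, 'b, 'e) module_scheme \<Rightarrow>
    ('a \<times> 'b \<Rightarrow> 'k) set"
  where "tensor_relators K A B =
    (let F = tensor_free K A B; e = (\<lambda>a b. free_gen K (a, b)) in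
      {e (a \<oplus>\<^bsub>A\<^esub> a') b \<ominus>\<^bsub>F\<^esub> (e a b \<oplus>\<^bsub>F\<^esub> e a' b) | a a' b.
          a \<in> carrier A \<and> a' \<in> carrier A \<and> b \<in> carrier B} \<union>
      {e a (b \<oplus>\<^bsub>B\<^esub> b') \<ominus>\<^bsub>F\<^esub> (e a b \<oplus>\<^bsub>F\<^esub> e a b') | a b b'.
          a \<in> carrier A \<and> b \<in> carrier B \<and> b' \<in> carrier B} \<union>
      {e (r \<odot>\<^bsub>A\<^esub> a) b \<ominus>\<^bsub>F\<^esub> (r \<odot>\<^bsub>F\<^esub> e a b) | r a b.
          r \<in> carrier K \<and> a \<in> carrier A \<and> b \<in> carrier B} \<union>
      {e a (r \<odot>\<^bsub>B\<^esub> b) \<ominus>\<^bsub>F\<^esub> (r \<odot>\<^bsub>F\<^esub> e a b) | r a b.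
          r \<in> carrier K \<and> a \<in> carrier A \<and> b \<in> carrier B})"

definition tensor_kernel ::
  "('k, 'c) ring_scheme \<Rightarrow> ('k, 'a, 'd) module_scheme \<Rightarrow> ('k, 'b, 'e) module_scheme \<Rightarrow>
    ('a \<times> 'b \<Rightarrow> 'k) set"
  where "tensor_kernel K A B =
    (\<lambda>H. submodule H K (tensor_free K A B)) hull tensor_relators K A B"

definition tensor ::
  "('k, 'c) ring_scheme \<Rightarrow> ('k, 'a, 'd) module_scheme \<Rightarrow> ('k, 'b, 'e) module_scheme \<Rightarrow>
    ('k, ('a \<times> 'b \<Rightarrow> 'k) set) module"  (infixl \<open>\<boxtimes>\<index>\<close> 75)
  where "tensor K A B = quot_module K (tensor_free K A B) (tensor_kernel K A B)"

definition pure ::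
  "('k, 'c) ring_scheme \<Rightarrow> ('k, 'a, 'd) module_scheme \<Rightarrow> ('k, 'b, 'e) module_scheme \<Rightarrow>
    'a \<Rightarrow> 'b \<Rightarrow> ('a \<times> 'b \<Rightarrow> 'k) set"
  where "pure K A B a b =
    tensor_kernel K A B +>\<^bsub>tensor_free K A B\<^esub> free_gen K (a, b)"

text \<open>The linear map on a tensor product induced by a bilinear map \<open>f\<close> into \<open>M\<close>: a class is sent
  to the value of the linear extension of \<open>f\<close> on a representative.  For bilinear \<open>f\<close> this does not
  depend on the representative.\<close>

definition tensor_lift ::
  "('k, 'c) ring_scheme \<Rightarrow> ('k, 'm, 'd) module_scheme \<Rightarrow> ('a \<Rightarrow> 'b \<Rightarrow> 'm) \<Rightarrow>
    ('a \<times> 'b \<Rightarrow> 'k) set \<Rightarrow> 'm"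
  where "tensor_lift K M f X =
    (let x = (SOME x. x \<in> X) in
      \<Oplus>\<^bsub>M\<^esub>p\<in>{p. x p \<noteq> \<zero>\<^bsub>K\<^esub>}. x p \<odot>\<^bsub>M\<^esub> f (fst p) (snd p))"

text \<open>The tensor product of two linear maps \<open>f\<close> and \<open>g\<close>, where \<open>M\<close> and \<open>N\<close> are the codomains
  of \<open>f\<close> and \<open>g\<close>.\<close>

definition tensor_map ::
  "('k, 'c) ring_scheme \<Rightarrow> ('k, 'm, 'd) module_scheme \<Rightarrow> ('k, 'n, 'e) module_scheme \<Rightarrow>
    ('a \<Rightarrow> 'm) \<Rightarrow> ('b \<Rightarrow> 'n) \<Rightarrow> ('a \<times> 'b \<Rightarrow> 'k) set \<Rightarrow> ('m \<times> 'n \<Rightarrow> 'k) set"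
  where "tensor_map K M N f g = tensor_lift K (M \<boxtimes>\<^bsub>K\<^esub> N) (\<lambda>a b. pure K M N (f a) (g b))"

text \<open>The associativity isomorphism from \<open>(A \<boxtimes> B) \<boxtimes> C\<close> to \<open>A \<boxtimes> (B \<boxtimes> C)\<close> and its inverse.
  The literature suppresses them.  Here an unbracketed triple tensor product always means the
  left-nested one.\<close>

definition tensor_assoc ::
  "('k, 'c) ring_scheme \<Rightarrow> ('k, 'x, 'd) module_scheme \<Rightarrow> ('k, 'y, 'e) module_scheme \<Rightarrow>
    ('k, 'z, 'f) module_scheme \<Rightarrow>
    (('x \<times> 'y \<Rightarrow> 'k) set \<times> 'z \<Rightarrow> 'k) set \<Rightarrow> ('x \<times> ('y \<times> 'z \<Rightarrow> 'k) set \<Rightarrow> 'k) set"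
  where "tensor_assoc K A B C =
    (let T = A \<boxtimes>\<^bsub>K\<^esub> (B \<boxtimes>\<^bsub>K\<^esub> C) in
      tensor_lift K T
        (\<lambda>t c. tensor_lift K T (\<lambda>a b. pure K A (B \<boxtimes>\<^bsub>K\<^esub> C) a (pure K B C b c)) t))"

definition tensor_assoc_inv ::
  "('k, 'c) ring_scheme \<Rightarrow> ('k, 'x, 'd) module_scheme \<Rightarrow> ('k, 'y, 'e) module_scheme \<Rightarrow>
    ('k, 'z, 'f) module_scheme \<Rightarrow>
    ('x \<times> ('y \<times> 'z \<Rightarrow> 'k) set \<Rightarrow> 'k) set \<Rightarrow> (('x \<times> 'y \<Rightarrow> 'k) set \<times> 'z \<Rightarrow> 'k) set"
  where "tensor_assoc_inv K A B C =
    (let T = (A \<boxtimes>\<^bsub>K\<^esub> B) \<boxtimes>\<^bsub>K\<^esub> C in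
      tensor_lift K T
        (\<lambda>a t. tensor_lift K T (\<lambda>b c. pure K (A \<boxtimes>\<^bsub>K\<^esub> B) C (pure K A B a b) c) t))"

text \<open>For \<open>f\<close> from \<open>M \<boxtimes> N\<close> to \<open>P \<boxtimes> Q\<close>, the map \<open>A \<boxtimes> f\<close> between the left-nested products
  \<open>(A \<boxtimes> M) \<boxtimes> N\<close> and \<open>(A \<boxtimes> P) \<boxtimes> Q\<close>.\<close>

definition tensor_map23 ::
  "('k, 'c) ring_scheme \<Rightarrow> ('k, 'a, 'd) module_scheme \<Rightarrow>
    ('k, 'm, 'e) module_scheme \<Rightarrow> ('k, 'n, 'f) module_scheme \<Rightarrow>
    ('k, 'p, 'g) module_scheme \<Rightarrow> ('k, 'q, 'h) module_scheme \<Rightarrow>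
    (('m \<times> 'n \<Rightarrow> 'k) set \<Rightarrow> ('p \<times> 'q \<Rightarrow> 'k) set) \<Rightarrow>
    (('a \<times> 'm \<Rightarrow> 'k) set \<times> 'n \<Rightarrow> 'k) set \<Rightarrow> (('a \<times> 'p \<Rightarrow> 'k) set \<times> 'q \<Rightarrow> 'k) set"
  where "tensor_map23 K A M N P Q f =
    tensor_assoc_inv K A P Q \<circ> tensor_map K A (P \<boxtimes>\<^bsub>K\<^esub> Q) id f \<circ> tensor_assoc K A M N"


section \<open>Twisting maps and twisted tensor products\<close>

definition mult_map ::
  "('k, 'c) ring_scheme \<Rightarrow> ('k, 'a, 'd) module_scheme \<Rightarrow> ('a \<times> 'a \<Rightarrow> 'k) set \<Rightarrow> 'a"
  where "mult_map K A = tensor_lift K A (mult A)"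

definition mult_map3 ::
  "('k, 'c) ring_scheme \<Rightarrow> ('k, 'a, 'd) module_scheme \<Rightarrow>
    (('a \<times> 'a \<Rightarrow> 'k) set \<times> 'a \<Rightarrow> 'k) set \<Rightarrow> 'a"
  where "mult_map3 K A = mult_map K A \<circ> tensor_map K A A (mult_map K A) id"

definition twisting_map ::
  "('k, 'c) ring_scheme \<Rightarrow> ('k, 'a, 'd) module_scheme \<Rightarrow> ('k, 'b, 'e) module_scheme \<Rightarrow>
    (('b \<times> 'a \<Rightarrow> 'k) set \<Rightarrow> ('a \<times> 'b \<Rightarrow> 'k) set) \<Rightarrow> bool"
  where "twisting_map K A B R \<longleftrightarrow>
    R \<in> linear_maps K (B \<boxtimes>\<^bsub>K\<^esub> A) (A \<boxtimes>\<^bsub>K\<^esub> B) \<and>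
    (\<forall>t\<in>carrier (B \<boxtimes>\<^bsub>K\<^esub> A \<boxtimes>\<^bsub>K\<^esub> A).
      (R \<circ> tensor_map K B A id (mult_map K A) \<circ> tensor_assoc K B A A) t =
      (tensor_map K A B (mult_map K A) id \<circ> tensor_map23 K A B A A B R \<circ>
        tensor_map K (A \<boxtimes>\<^bsub>K\<^esub> B) A R id) t) \<and>
    (\<forall>t\<in>carrier (B \<boxtimes>\<^bsub>K\<^esub> B \<boxtimes>\<^bsub>K\<^esub> A).
      (R \<circ> tensor_map K B A (mult_map K B) id) t =
      (tensor_map K A B id (mult_map K B) \<circ> tensor_assoc K A B B \<circ>
        tensor_map K (A \<boxtimes>\<^bsub>K\<^esub> B) B R id \<circ> tensor_map23 K B B A A B R) t)"

definition unital_twisting_map ::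
  "('k, 'c) ring_scheme \<Rightarrow> ('k, 'a, 'd) module_scheme \<Rightarrow> ('k, 'b, 'e) module_scheme \<Rightarrow>
    (('b \<times> 'a \<Rightarrow> 'k) set \<Rightarrow> ('a \<times> 'b \<Rightarrow> 'k) set) \<Rightarrow> bool"
  where "unital_twisting_map K A B R \<longleftrightarrow>
    twisting_map K A B R \<and>
    (\<forall>a\<in>carrier A. R (pure K B A \<one>\<^bsub>B\<^esub> a) = pure K A B a \<one>\<^bsub>B\<^esub>) \<and>
    (\<forall>b\<in>carrier B. R (pure K B A b \<one>\<^bsub>A\<^esub>) = pure K A B \<one>\<^bsub>A\<^esub> b)"

text \<open>The product map of the twisted tensor product is the composite
  \<open>(A \<boxtimes> B) \<boxtimes> (A \<boxtimes> B) \<rightarrow> ((A \<boxtimes> B) \<boxtimes> A) \<boxtimes> B \<rightarrow> ((A \<boxtimes> A) \<boxtimes> B) \<boxtimes> B \<rightarrow> (A \<boxtimes> A) \<boxtimes> (B \<boxtimes> B) \<rightarrow> A \<boxtimes> B\<close>,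
  where the second arrow is \<open>A \<boxtimes> R \<boxtimes> B\<close> and the last is the product of \<open>A\<close> tensored with that
  of \<open>B\<close>.\<close>

definition twisted_mult_map ::
  "('k, 'c) ring_scheme \<Rightarrow> ('k, 'a, 'd) module_scheme \<Rightarrow> ('k, 'b, 'e) module_scheme \<Rightarrow>
    (('b \<times> 'a \<Rightarrow> 'k) set \<Rightarrow> ('a \<times> 'b \<Rightarrow> 'k) set) \<Rightarrow>
    (('a \<times> 'b \<Rightarrow> 'k) set \<times> ('a \<times> 'b \<Rightarrow> 'k) set \<Rightarrow> 'k) set \<Rightarrow> ('a \<times> 'b \<Rightarrow> 'k) set"
  where "twisted_mult_map K A B R =
    tensor_map K A B (mult_map K A) (mult_map K B) \<circ>
    tensor_assoc K (A \<boxtimes>\<^bsub>K\<^esub> A) B B \<circ>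
    tensor_map K (A \<boxtimes>\<^bsub>K\<^esub> A \<boxtimes>\<^bsub>K\<^esub> B) B (tensor_map23 K A B A A B R) id \<circ>
    tensor_assoc_inv K (A \<boxtimes>\<^bsub>K\<^esub> B) A B"

definition twisted_tensor ::
  "('k, 'c) ring_scheme \<Rightarrow> ('k, 'a, 'd) module_scheme \<Rightarrow> ('k, 'b, 'e) module_scheme \<Rightarrow>
    (('b \<times> 'a \<Rightarrow> 'k) set \<Rightarrow> ('a \<times> 'b \<Rightarrow> 'k) set) \<Rightarrow> ('k, ('a \<times> 'b \<Rightarrow> 'k) set) module"
  where "twisted_tensor K A B R =
    (A \<boxtimes>\<^bsub>K\<^esub> B)
      \<lparr>mult := (\<lambda>x y. twisted_mult_map K A B R (pure K (A \<boxtimes>\<^bsub>K\<^esub> B) (A \<boxtimes>\<^bsub>K\<^esub> B) x y)),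
       one := pure K A B \<one>\<^bsub>A\<^esub> \<one>\<^bsub>B\<^esub>\<rparr>"

definition hexagon ::
  "('k, 'c) ring_scheme \<Rightarrow> ('k, 'x, 'd) module_scheme \<Rightarrow> ('k, 'y, 'e) module_scheme \<Rightarrow>
    ('k, 'z, 'f) module_scheme \<Rightarrow>
    (('y \<times> 'x \<Rightarrow> 'k) set \<Rightarrow> ('x \<times> 'y \<Rightarrow> 'k) set) \<Rightarrow>
    (('z \<times> 'y \<Rightarrow> 'k) set \<Rightarrow> ('y \<times> 'z \<Rightarrow> 'k) set) \<Rightarrow>
    (('z \<times> 'x \<Rightarrow> 'k) set \<Rightarrow> ('x \<times> 'z \<Rightarrow> 'k) set) \<Rightarrow> bool"
  where "hexagon K A B C R1 R2 R3 \<longleftrightarrow>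
    (\<forall>t\<in>carrier (C \<boxtimes>\<^bsub>K\<^esub> B \<boxtimes>\<^bsub>K\<^esub> A).
      (tensor_map23 K A C B B C R2 \<circ> tensor_map K (A \<boxtimes>\<^bsub>K\<^esub> C) B R3 id \<circ>
        tensor_map23 K C B A A B R1) t =
      (tensor_map K (A \<boxtimes>\<^bsub>K\<^esub> B) C R1 id \<circ> tensor_map23 K B C A A C R3 \<circ>
        tensor_map K (B \<boxtimes>\<^bsub>K\<^esub> C) A R2 id) t)"

text \<open>The twisting map \<open>C \<boxtimes> (A \<boxtimes> B) \<rightarrow> (A \<boxtimes> B) \<boxtimes> C\<close> from which the left-bracketed iterated twisted
  tensor product is formed.\<close>

definition iterated_twist ::
  "('k, 'c) ring_scheme \<Rightarrow> ('k, 'x, 'd) module_scheme \<Rightarrow> ('k, 'y, 'e) module_scheme \<Rightarrow>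
    ('k, 'z, 'f) module_scheme \<Rightarrow>
    (('z \<times> 'y \<Rightarrow> 'k) set \<Rightarrow> ('y \<times> 'z \<Rightarrow> 'k) set) \<Rightarrow>
    (('z \<times> 'x \<Rightarrow> 'k) set \<Rightarrow> ('x \<times> 'z \<Rightarrow> 'k) set) \<Rightarrow>
    ('z \<times> ('x \<times> 'y \<Rightarrow> 'k) set \<Rightarrow> 'k) set \<Rightarrow> (('x \<times> 'y \<Rightarrow> 'k) set \<times> 'z \<Rightarrow> 'k) set"
  where "iterated_twist K A B C R2 R3 =
    tensor_map23 K A C B B C R2 \<circ> tensor_map K (A \<boxtimes>\<^bsub>K\<^esub> C) B R3 id \<circ> tensor_assoc_inv K C A B"

definition iterated_twisted_tensor ::
  "('k, 'c) ring_scheme \<Rightarrow> ('k, 'x, 'd) module_scheme \<Rightarrow> ('k, 'y, 'e) module_scheme \<Rightarrow>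
    ('k, 'z, 'f) module_scheme \<Rightarrow>
    (('y \<times> 'x \<Rightarrow> 'k) set \<Rightarrow> ('x \<times> 'y \<Rightarrow> 'k) set) \<Rightarrow>
    (('z \<times> 'y \<Rightarrow> 'k) set \<Rightarrow> ('y \<times> 'z \<Rightarrow> 'k) set) \<Rightarrow>
    (('z \<times> 'x \<Rightarrow> 'k) set \<Rightarrow> ('x \<times> 'z \<Rightarrow> 'k) set) \<Rightarrow>
    ('k, (('x \<times> 'y \<Rightarrow> 'k) set \<times> 'z \<Rightarrow> 'k) set) module"
  where "iterated_twisted_tensor K A B C R1 R2 R3 =
    twisted_tensor K (twisted_tensor K A B R1) C (iterated_twist K A B C R2 R3)"

definition pure3 ::
  "('k, 'c) ring_scheme \<Rightarrow> ('k, 'x, 'd) module_scheme \<Rightarrow> ('k, 'y, 'e) module_scheme \<Rightarrow>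
    ('k, 'z, 'f) module_scheme \<Rightarrow> 'x \<Rightarrow> 'y \<Rightarrow> 'z \<Rightarrow> (('x \<times> 'y \<Rightarrow> 'k) set \<times> 'z \<Rightarrow> 'k) set"
  where "pure3 K A B C a b c = pure K (A \<boxtimes>\<^bsub>K\<^esub> B) C (pure K A B a b) c"

definition tensor_map3 ::
  "('k, 'c) ring_scheme \<Rightarrow> ('k, 'm, 'd) module_scheme \<Rightarrow>
    ('x \<Rightarrow> 'm) \<Rightarrow> ('y \<Rightarrow> 'm) \<Rightarrow> ('z \<Rightarrow> 'm) \<Rightarrow>
    (('x \<times> 'y \<Rightarrow> 'k) set \<times> 'z \<Rightarrow> 'k) set \<Rightarrow> (('m \<times> 'm \<Rightarrow> 'k) set \<times> 'm \<Rightarrow> 'k) set"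
  where "tensor_map3 K X u v w = tensor_map K (X \<boxtimes>\<^bsub>K\<^esub> X) X (tensor_map K X X u v) w"

end

theory Submission
  imports Defs
begin

text \<open>Two algebra morphisms \<open>f : A \<rightarrow> X\<close> and \<open>g : B \<rightarrow> X\<close> combine to a morphism
  \<open>a \<otimes> b \<mapsto> f a \<cdot> g b\<close> on \<open>A \<otimes>\<^sub>R B\<close> as soon as moving \<open>g b\<close> past \<open>f a\<close> in \<open>X\<close> is governed by \<open>R\<close>.
  Putting one of the three arguments equal to 1 in the hypothesis on \<open>u, v, w\<close> yields, by unitality,
  the three pairwise crossing relations. The relation for \<open>R1\<close> gives a morphism \<open>uv\<close> on
  \<open>A \<otimes>\<^sub>R\<^sub>1 B\<close>, and those for \<open>R2\<close> and \<open>R3\<close> combine to the crossing relation between \<open>w\<close> and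
  \<open>uv\<close> with respect to \<open>T\<^sub>1\<close>, so the two-fold construction applies a second time. Uniqueness
  follows from \<open>a \<otimes> b \<otimes> c = (i\<^sub>A a \<cdot> i\<^sub>B b) \<cdot> i\<^sub>C c\<close>.\<close>

section \<open>Linear and bilinear maps\<close>

text \<open>A twisting map sends a pure tensor to a tensor that is in general not pure, whereas
  linear maps on a tensor product are compared on pure tensors only. This shapes most of the
  arguments below: wherever a map is evaluated at such a value, the value is replaced by an
  arbitrary tensor \<open>t\<close>, both sides are shown to be linear in \<open>t\<close>, and
  \<open>tensor_ext\<close> reduces the claim to pure \<open>t\<close>. That is why nearly every map
  comes with two facts, its linearity and its value on pure tensors.

  Inserting a unit isolates one crossing relation for the following reason. Each of the algebras
  \<open>A\<close>, \<open>B\<close>, \<open>C\<close> takes part in exactly two of the maps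
  \<open>R1\<close>, \<open>R2\<close>, \<open>R3\<close>. A unit in one argument therefore turns
  two of them into mere flips and leaves the third.

  Functions in HOL are total, so a map on a carrier is unique only after its values elsewhere are
  fixed. This is the purpose of \<open>extensional\<close> in the statement and of
  \<open>restrict\<close> in the construction.\<close>

lemma linear_mapsI:
  assumes "\<And>x. x \<in> carrier M \<Longrightarrow> f x \<in> carrier N"
    and "\<And>x y. x \<in> carrier M \<Longrightarrow> y \<in> carrier M \<Longrightarrow> f (x \<oplus>\<^bsub>M\<^esub> y) = f x \<oplus>\<^bsub>N\<^esub> f y"
    and "\<And>r x. r \<in> carrier K \<Longrightarrow> x \<in> carrier M \<Longrightarrow> f (r \<odot>\<^bsub>M\<^esub> x) = r \<odot>\<^bsub>N\<^esub> f x"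
  shows "f \<in> linear_maps K M N"
  using assms by (auto simp: linear_maps_def)

lemma linear_mapsD:
  assumes "f \<in> linear_maps K M N"
  shows "x \<in> carrier M \<Longrightarrow> f x \<in> carrier N"
    and "x \<in> carrier M \<Longrightarrow> y \<in> carrier M \<Longrightarrow> f (x \<oplus>\<^bsub>M\<^esub> y) = f x \<oplus>\<^bsub>N\<^esub> f y"
    and "r \<in> carrier K \<Longrightarrow> x \<in> carrier M \<Longrightarrow> f (r \<odot>\<^bsub>M\<^esub> x) = r \<odot>\<^bsub>N\<^esub> f x"
  using assms by (auto simp: linear_maps_def)

lemma linear_maps_compose:
  assumes "f \<in> linear_maps K N P" "g \<in> linear_maps K M N"
  shows "(\<lambda>x. f (g x)) \<in> linear_maps K M P"
  using assms by (auto simp: linear_maps_def Pi_iff)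

lemma linear_maps_id: "id \<in> linear_maps K M M"
  by (auto simp: linear_maps_def)

lemma linear_maps_add:
  assumes "module K N" "f \<in> linear_maps K M N" "g \<in> linear_maps K M N"
  shows "(\<lambda>x. f x \<oplus>\<^bsub>N\<^esub> g x) \<in> linear_maps K M N"
proof -
  interpret N: module K N by fact
  show ?thesis
    by (rule linear_mapsI)
      (simp_all add: linear_mapsD[OF assms(2)] linear_mapsD[OF assms(3)] N.smult_r_distr N.add.m_ac)
qed

lemma linear_maps_smult:
  assumes "module K N" "f \<in> linear_maps K M N" "r \<in> carrier K"
  shows "(\<lambda>x. r \<odot>\<^bsub>N\<^esub> f x) \<in> linear_maps K M N"
proof -
  interpret N: module K N by fact
  show ?thesis
  proof (rule linear_mapsI)
    show "r \<odot>\<^bsub>N\<^esub> f (s \<odot>\<^bsub>M\<^esub> x) = s \<odot>\<^bsub>N\<^esub> (r \<odot>\<^bsub>N\<^esub> f x)" if "s \<in> carrier K" "x \<in> carrier M" for s x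
      using that assms(3) N.smult_assoc1[of r s "f x"] N.smult_assoc1[of s r "f x"] N.R.m_comm[of r s]
      by (simp add: linear_mapsD[OF assms(2)])
  qed (simp_all add: linear_mapsD[OF assms(2)] assms(3) N.smult_r_distr)
qed

lemma linear_maps_zero:
  assumes "module K M" "module K N" "f \<in> linear_maps K M N"
  shows "f \<zero>\<^bsub>M\<^esub> = \<zero>\<^bsub>N\<^esub>"
proof -
  interpret M: module K M by fact
  interpret N: module K N by fact
  have "f (\<zero>\<^bsub>K\<^esub> \<odot>\<^bsub>M\<^esub> \<zero>\<^bsub>M\<^esub>) = \<zero>\<^bsub>K\<^esub> \<odot>\<^bsub>N\<^esub> f \<zero>\<^bsub>M\<^esub>"
    by (rule linear_mapsD(3)[OF assms(3)]) simp_all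
  then show ?thesis
    using linear_mapsD(1)[OF assms(3) M.M.zero_closed] by simp
qed

lemma linear_maps_minus:
  assumes "module K M" "module K N" "f \<in> linear_maps K M N" "x \<in> carrier M"
  shows "f (\<ominus>\<^bsub>M\<^esub> x) = \<ominus>\<^bsub>N\<^esub> f x"
proof -
  interpret M: module K M by fact
  interpret N: module K N by fact
  have "f (\<ominus>\<^bsub>M\<^esub> x) \<oplus>\<^bsub>N\<^esub> f x = f (\<ominus>\<^bsub>M\<^esub> x \<oplus>\<^bsub>M\<^esub> x)"
    using assms(4) by (simp add: linear_mapsD[OF assms(3)])
  also have "\<dots> = \<zero>\<^bsub>N\<^esub>"
    using assms(4) by (simp add: M.M.l_neg linear_maps_zero[OF assms(1-3)])
  finally show ?thesis
    using assms(4) by (intro N.M.minus_equality[symmetric]) (simp_all add: linear_mapsD[OF assms(3)])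
qed

definition bilinear_maps ::
  "('k, 'c) ring_scheme \<Rightarrow> ('k, 'a, 'd) module_scheme \<Rightarrow> ('k, 'b, 'e) module_scheme \<Rightarrow>
    ('k, 'm, 'f) module_scheme \<Rightarrow> ('a \<Rightarrow> 'b \<Rightarrow> 'm) set"
  where "bilinear_maps K A B M =
    {f. (\<forall>a\<in>carrier A. f a \<in> linear_maps K B M) \<and>
        (\<forall>b\<in>carrier B. (\<lambda>a. f a b) \<in> linear_maps K A M)}"

lemma bilinear_mapsI:
  assumes "\<And>a. a \<in> carrier A \<Longrightarrow> (\<lambda>b. f a b) \<in> linear_maps K B M"
    and "\<And>b. b \<in> carrier B \<Longrightarrow> (\<lambda>a. f a b) \<in> linear_maps K A M"
  shows "f \<in> bilinear_maps K A B M"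
  using assms by (simp add: bilinear_maps_def)

lemma bilinear_mapsD:
  assumes "f \<in> bilinear_maps K A B M"
  shows "a \<in> carrier A \<Longrightarrow> (\<lambda>b. f a b) \<in> linear_maps K B M"
    and "b \<in> carrier B \<Longrightarrow> (\<lambda>a. f a b) \<in> linear_maps K A M"
  using assms by (simp_all add: bilinear_maps_def)

lemma bilinear_maps_closed:
  assumes "f \<in> bilinear_maps K A B M" "a \<in> carrier A" "b \<in> carrier B"
  shows "f a b \<in> carrier M"
  using linear_mapsD(1)[OF bilinear_mapsD(1)] assms .

lemma bilinear_maps_compose:
  assumes "f \<in> bilinear_maps K A' B' M" "g \<in> linear_maps K A A'" "h \<in> linear_maps K B B'"
  shows "(\<lambda>a b. f (g a) (h b)) \<in> bilinear_maps K A B M"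
proof (rule bilinear_mapsI)
  show "(\<lambda>b. f (g a) (h b)) \<in> linear_maps K B M" if "a \<in> carrier A" for a
    by (rule linear_maps_compose[OF bilinear_mapsD(1)[OF assms(1) linear_mapsD(1)[OF assms(2) that]] assms(3)])
  show "(\<lambda>a. f (g a) (h b)) \<in> linear_maps K A M" if "b \<in> carrier B" for b
    by (rule linear_maps_compose[OF bilinear_mapsD(2)[OF assms(1) linear_mapsD(1)[OF assms(3) that]] assms(2)])
qed

lemma linear_bilinear_compose:
  assumes "g \<in> linear_maps K M N" "f \<in> bilinear_maps K A B M"
  shows "(\<lambda>a b. g (f a b)) \<in> bilinear_maps K A B N"
  by (rule bilinear_mapsI) (auto intro: linear_maps_compose[OF assms(1)] bilinear_mapsD[OF assms(2)])

lemma assoc_algebra_bilinear_mult: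
  assumes "assoc_algebra K A"
  shows "mult A \<in> bilinear_maps K A A A"
proof -
  interpret assoc_algebra K A by fact
  show ?thesis
    by (intro bilinear_mapsI linear_mapsI)
      (simp_all add: l_distr r_distr smult_mult_left smult_mult_right)
qed


section \<open>Quotients of modules\<close>

context module
begin

context
  fixes N
  assumes N: "submodule N R M"
begin

lemma submodule_abelian_subgroup: "abelian_subgroup N M"
  by (intro abelian_subgroupI3 additive_subgroupI submodule.axioms(1)[OF N] M.abelian_group_axioms)

interpretation abelian_subgroup N M
  by (rule submodule_abelian_subgroup)

lemma quot_module_carrier: "carrier (quot_module R M N) = (\<lambda>x. N +>\<^bsub>M\<^esub> x) ` carrier M"
  by (auto simp: quot_module_def A_RCOSETS_def')

lemma quot_module_zero: "\<zero>\<^bsub>quot_module R M N\<^esub> = N +>\<^bsub>M\<^esub> \<zero>\<^bsub>M\<^esub>"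
  by (simp add: quot_module_def a_rcos_const)

lemma quot_module_add:
  assumes "x \<in> carrier M" "y \<in> carrier M"
  shows "(N +>\<^bsub>M\<^esub> x) \<oplus>\<^bsub>quot_module R M N\<^esub> (N +>\<^bsub>M\<^esub> y) = N +>\<^bsub>M\<^esub> (x \<oplus>\<^bsub>M\<^esub> y)"
  using assms by (simp add: quot_module_def a_rcos_sum)

lemma coset_eq_iff:
  assumes "x \<in> carrier M" "y \<in> carrier M"
  shows "N +>\<^bsub>M\<^esub> x = N +>\<^bsub>M\<^esub> y \<longleftrightarrow> x \<ominus>\<^bsub>M\<^esub> y \<in> N"
proof -
  have "N +>\<^bsub>M\<^esub> x = N +>\<^bsub>M\<^esub> y \<longleftrightarrow> x \<in> N +>\<^bsub>M\<^esub> y"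
    using a_repr_independence'[OF _ assms(2)] a_rcos_self[OF assms(1)] by metis
  then show ?thesis
    using a_rcos_module[OF assms(2,1)] by (simp only: a_minus_def)
qed

text \<open>The scalar action is defined as a union over all representatives \<open>y\<close> of the
  coset. Since \<open>y - x\<close> lies in \<open>N\<close>, so does its multiple by
  \<open>r\<close>, hence all cosets in the union coincide.\<close>

lemma quot_module_smult:
  assumes "r \<in> carrier R" "x \<in> carrier M"
  shows "r \<odot>\<^bsub>quot_module R M N\<^esub> (N +>\<^bsub>M\<^esub> x) = N +>\<^bsub>M\<^esub> (r \<odot>\<^bsub>M\<^esub> x)"
proof -
  have eq: "N +>\<^bsub>M\<^esub> (r \<odot>\<^bsub>M\<^esub> y) = N +>\<^bsub>M\<^esub> (r \<odot>\<^bsub>M\<^esub> x)" if "y \<in> N +>\<^bsub>M\<^esub> x" for y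
  proof -
    have y: "y \<in> carrier M" using a_elemrcos_carrier assms(2) that .
    have "r \<odot>\<^bsub>M\<^esub> (y \<oplus>\<^bsub>M\<^esub> \<ominus>\<^bsub>M\<^esub> x) \<in> N"
      using submodule.smult_closed[OF N assms(1) a_rcos_module_imp[OF assms(2) that]] .
    then show ?thesis
      using assms y by (simp add: coset_eq_iff a_minus_def smult_r_distr smult_r_minus)
  qed
  have "r \<odot>\<^bsub>quot_module R M N\<^esub> (N +>\<^bsub>M\<^esub> x) = (\<Union>y\<in>N +>\<^bsub>M\<^esub> x. N +>\<^bsub>M\<^esub> (r \<odot>\<^bsub>M\<^esub> y))"
    by (simp add: quot_module_def)
  also have "\<dots> = N +>\<^bsub>M\<^esub> (r \<odot>\<^bsub>M\<^esub> x)"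
    by (intro UN_constant_eq[OF a_rcos_self[OF assms(2)]] ballI eq)
  finally show ?thesis .
qed

lemma quot_module: "module R (quot_module R M N)"
proof -
  have "abelian_group (quot_module R M N)"
  proof (rule abelian_groupI)
    show "\<exists>Y\<in>carrier (quot_module R M N). Y \<oplus>\<^bsub>quot_module R M N\<^esub> X = \<zero>\<^bsub>quot_module R M N\<^esub>"
      if X: "X \<in> carrier (quot_module R M N)" for X
    proof -
      obtain x where x: "x \<in> carrier M" "X = N +>\<^bsub>M\<^esub> x"
        using X by (auto simp: quot_module_carrier)
      then show ?thesis
        by (intro bexI[of _ "N +>\<^bsub>M\<^esub> (\<ominus>\<^bsub>M\<^esub> x)"])
          (simp_all add: quot_module_carrier quot_module_add quot_module_zero M.l_neg)
    qed
  qed (auto simp: quot_module_carrier quot_module_add quot_module_zero M.add.m_ac)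
  then show ?thesis
    by (intro moduleI R.is_cring)
      (auto simp: quot_module_carrier quot_module_add quot_module_smult smult_l_distr smult_r_distr
        smult_assoc1)
qed

end

end


section \<open>Free modules\<close>

lemma free_module_simps:
  "\<zero>\<^bsub>free_module K S\<^esub> = (\<lambda>s. \<zero>\<^bsub>K\<^esub>)"
  "f \<oplus>\<^bsub>free_module K S\<^esub> g = (\<lambda>s. f s \<oplus>\<^bsub>K\<^esub> g s)"
  "r \<odot>\<^bsub>free_module K S\<^esub> f = (\<lambda>s. r \<otimes>\<^bsub>K\<^esub> f s)"
  by (simp_all add: free_module_def)

text \<open>The linear map from the free module that sends the generator at \<open>p\<close> to
  \<open>f p\<close>. The sum over the support has the same shape as in \<open>tensor_lift\<close>,
  so that a lift is the value of this map at the chosen representative.\<close>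

definition linear_extension ::
  "('k, 'c) ring_scheme \<Rightarrow> ('k, 'm, 'd) module_scheme \<Rightarrow> ('s \<Rightarrow> 'm) \<Rightarrow> ('s \<Rightarrow> 'k) \<Rightarrow> 'm"
  where "linear_extension K M f x = (\<Oplus>\<^bsub>M\<^esub>p\<in>{p. x p \<noteq> \<zero>\<^bsub>K\<^esub>}. x p \<odot>\<^bsub>M\<^esub> f p)"

context cring
begin

lemma free_module_carrier_iff:
  "f \<in> carrier (free_module R S) \<longleftrightarrow>
    (\<forall>s. f s \<in> carrier R) \<and> {s. f s \<noteq> \<zero>} \<subseteq> S \<and> finite {s. f s \<noteq> \<zero>}"
proof -
  have "\<forall>s. f s \<in> carrier R" if "\<forall>s\<in>S. f s \<in> carrier R" "\<forall>s. s \<notin> S \<longrightarrow> f s = \<zero>"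
    using that by (metis zero_closed)
  then show ?thesis by (auto simp: free_module_def)
qed

lemma free_module: "module R (free_module R S)"
proof -
  let ?F = "free_module R S"
  have add: "(\<lambda>s. f s \<oplus> g s) \<in> carrier ?F" if "f \<in> carrier ?F" "g \<in> carrier ?F" for f g
  proof -
    have sub: "{s. f s \<oplus> g s \<noteq> \<zero>} \<subseteq> {s. f s \<noteq> \<zero>} \<union> {s. g s \<noteq> \<zero>}" by auto
    moreover have "finite {s. f s \<oplus> g s \<noteq> \<zero>}"
      using that by (intro finite_subset[OF sub]) (simp add: free_module_carrier_iff)
    moreover have "{s. f s \<oplus> g s \<noteq> \<zero>} \<subseteq> S"
      using that by (intro subset_trans[OF sub]) (simp add: free_module_carrier_iff)
    ultimately show ?thesis
      using that by (simp add: free_module_carrier_iff)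
  qed
  have smult: "(\<lambda>s. r \<otimes> f s) \<in> carrier ?F" if "r \<in> carrier R" "f \<in> carrier ?F" for r f
  proof -
    have sub: "{s. r \<otimes> f s \<noteq> \<zero>} \<subseteq> {s. f s \<noteq> \<zero>}" using that by auto
    moreover have "finite {s. r \<otimes> f s \<noteq> \<zero>}"
      using that by (intro finite_subset[OF sub]) (simp add: free_module_carrier_iff)
    moreover have "{s. r \<otimes> f s \<noteq> \<zero>} \<subseteq> S"
      using that by (intro subset_trans[OF sub]) (simp add: free_module_carrier_iff)
    ultimately show ?thesis
      using that by (simp add: free_module_carrier_iff)
  qed
  have zero: "(\<lambda>s. \<zero>) \<in> carrier ?F" by (simp add: free_module_carrier_iff)
  have closed: "f s \<in> carrier R" if "f \<in> carrier ?F" for f s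
    using that by (simp add: free_module_carrier_iff)
  have "abelian_group ?F"
  proof (rule abelian_groupI, goal_cases)
    \<comment> \<open>The sixth goal of \<open>abelian_groupI\<close> is the existence of an
      additive inverse. Multiplying by minus one gives a witness whose membership is already covered
      by \<open>smult\<close>.\<close>
    case (6 f)
    then have "(\<lambda>s. (\<ominus> \<one>) \<otimes> f s) \<in> carrier ?F" by (intro smult) auto
    moreover have "(\<lambda>s. (\<ominus> \<one>) \<otimes> f s) \<oplus>\<^bsub>?F\<^esub> f = \<zero>\<^bsub>?F\<^esub>"
      using closed[OF 6] by (simp add: free_module_simps l_minus l_neg)
    ultimately show ?case by blast
  qed (simp_all add: free_module_simps add zero closed a_ac)
  then show ?thesis
    by (rule moduleI[OF is_cring])
      (simp_all add: free_module_simps smult closed l_distr r_distr m_assoc)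
qed

lemma free_gen_in_free_module: "s \<in> S \<Longrightarrow> free_gen R s \<in> carrier (free_module R S)"
  by (simp add: free_module_carrier_iff free_gen_def subset_iff)

text \<open>Induction on the support, splitting off one point \<open>s\<close> at a time. Scalars
  enter through the case \<open>gen\<close>, because sums of bare generators would not reach every
  element.\<close>

lemma free_module_induct [consumes 1, case_names zero gen add]:
  assumes "f \<in> carrier (free_module R S)"
    and zero: "P \<zero>\<^bsub>free_module R S\<^esub>"
    and gen: "\<And>r s. r \<in> carrier R \<Longrightarrow> s \<in> S \<Longrightarrow> P (r \<odot>\<^bsub>free_module R S\<^esub> free_gen R s)"
    and add: "\<And>f g. f \<in> carrier (free_module R S) \<Longrightarrow> g \<in> carrier (free_module R S) \<Longrightarrow>
      P f \<Longrightarrow> P g \<Longrightarrow> P (f \<oplus>\<^bsub>free_module R S\<^esub> g)"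
  shows "P f"
proof -
  let ?F = "free_module R S"
  interpret F: module R ?F by (rule free_module)
  define T where "T = {s. f s \<noteq> \<zero>}"
  have "finite T" using assms(1) by (simp add: free_module_carrier_iff T_def)
  then show "P f"
    using T_def assms(1)
  proof (induction T arbitrary: f rule: finite_induct)
    case empty
    then have "f = \<zero>\<^bsub>?F\<^esub>" by (auto simp: free_module_simps)
    then show ?case using zero by simp
  next
    case (insert s T)
    from insert.prems have closed: "f t \<in> carrier R" for t by (simp add: free_module_carrier_iff)
    from insert.prems have s: "s \<in> S" by (auto simp: free_module_carrier_iff)
    have T: "T = {t. (f(s := \<zero>)) t \<noteq> \<zero>}" using insert.hyps insert.prems by auto
    have g: "f(s := \<zero>) \<in> carrier ?F"
      unfolding free_module_carrier_iff T[symmetric]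
      using insert.hyps insert.prems closed by (auto simp: free_module_carrier_iff)
    have "f = f s \<odot>\<^bsub>?F\<^esub> free_gen R s \<oplus>\<^bsub>?F\<^esub> f(s := \<zero>)"
      using closed by (auto simp: free_module_simps free_gen_def)
    moreover have "P (f s \<odot>\<^bsub>?F\<^esub> free_gen R s \<oplus>\<^bsub>?F\<^esub> f(s := \<zero>))"
      by (intro add gen s closed insert.IH[OF T g] g F.smult_closed free_gen_in_free_module)
    ultimately show ?case by simp
  qed
qed

end

context module
begin

text \<open>Enlarging the summation range beyond the support adds only zero terms. Additivity needs
  this: \<open>x\<close>, \<open>y\<close> and their sum have different supports, and cancellation
  may make that of the sum smaller, so all three are summed over one common set.\<close>

lemma linear_extension_eq_finsum:
  assumes "f \<in> S \<rightarrow> carrier M" "x \<in> carrier (free_module R S)"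
    and "finite T" "{p. x p \<noteq> \<zero>} \<subseteq> T" "T \<subseteq> S"
  shows "linear_extension R M f x = (\<Oplus>\<^bsub>M\<^esub>p\<in>T. x p \<odot>\<^bsub>M\<^esub> f p)"
  unfolding linear_extension_def
proof (rule M.add.finprod_mono_neutral_cong_left[OF assms(3,4)])
  have f_closed: "f p \<in> carrier M" if "p \<in> T" for p
    using assms(1,5) that by auto
  show "x p \<odot>\<^bsub>M\<^esub> f p = \<zero>\<^bsub>M\<^esub>" if "p \<in> T - {p. x p \<noteq> \<zero>}" for p
    using that by (simp add: f_closed)
  show "(\<lambda>p. x p \<odot>\<^bsub>M\<^esub> f p) \<in> T \<rightarrow> carrier M"
    using assms(2) f_closed by (simp add: R.free_module_carrier_iff)
qed simp

lemma linear_extension_linear: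
  assumes f: "f \<in> S \<rightarrow> carrier M"
  shows "linear_extension R M f \<in> linear_maps R (free_module R S) M"
proof (rule linear_mapsI)
  let ?F = "free_module R S"
  interpret F: module R ?F by (rule R.free_module)
  have closed: "x p \<in> carrier R" if "x \<in> carrier ?F" for x p
    using that by (simp add: R.free_module_carrier_iff)
  have f_closed: "f p \<in> carrier M" if "p \<in> S" for p
    using f that by auto
  show "linear_extension R M f x \<in> carrier M" if "x \<in> carrier ?F" for x
    unfolding linear_extension_def using that
    by (intro M.finsum_closed) (auto simp: R.free_module_carrier_iff f_closed)
  show "linear_extension R M f (x \<oplus>\<^bsub>?F\<^esub> y) = linear_extension R M f x \<oplus>\<^bsub>M\<^esub> linear_extension R M f y"
    if xy: "x \<in> carrier ?F" "y \<in> carrier ?F" for x y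
  proof -
    define T where "T = {p. x p \<noteq> \<zero>} \<union> {p. y p \<noteq> \<zero>}"
    have T: "finite T" "T \<subseteq> S" "{p. x p \<noteq> \<zero>} \<subseteq> T" "{p. y p \<noteq> \<zero>} \<subseteq> T"
      using xy by (auto simp: T_def R.free_module_carrier_iff)
    have T': "{p. (x \<oplus>\<^bsub>?F\<^esub> y) p \<noteq> \<zero>} \<subseteq> T"
      by (auto simp: T_def free_module_simps)
    have "linear_extension R M f (x \<oplus>\<^bsub>?F\<^esub> y) = (\<Oplus>\<^bsub>M\<^esub>p\<in>T. (x \<oplus>\<^bsub>?F\<^esub> y) p \<odot>\<^bsub>M\<^esub> f p)"
      by (rule linear_extension_eq_finsum[OF f F.a_closed[OF xy] T(1) T' T(2)])
    also have "\<dots> = (\<Oplus>\<^bsub>M\<^esub>p\<in>T. x p \<odot>\<^bsub>M\<^esub> f p \<oplus>\<^bsub>M\<^esub> y p \<odot>\<^bsub>M\<^esub> f p)"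
      using T(2) by (intro M.finsum_cong' refl)
        (auto simp: free_module_simps closed[OF xy(1)] closed[OF xy(2)] f_closed smult_l_distr)
    also have "\<dots> = linear_extension R M f x \<oplus>\<^bsub>M\<^esub> linear_extension R M f y"
      unfolding linear_extension_eq_finsum[OF f xy(1) T(1) T(3) T(2)]
        linear_extension_eq_finsum[OF f xy(2) T(1) T(4) T(2)]
      using T(2) by (intro M.finsum_addf) (auto simp: closed[OF xy(1)] closed[OF xy(2)] f_closed)
    finally show ?thesis .
  qed
  show "linear_extension R M f (r \<odot>\<^bsub>?F\<^esub> x) = r \<odot>\<^bsub>M\<^esub> linear_extension R M f x"
    if r: "r \<in> carrier R" and x: "x \<in> carrier ?F" for r x
  proof -
    define T where "T = {p. x p \<noteq> \<zero>}"
    have T: "finite T" "T \<subseteq> S" "{p. x p \<noteq> \<zero>} \<subseteq> T"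
      using x by (auto simp: T_def R.free_module_carrier_iff)
    have T': "{p. (r \<odot>\<^bsub>?F\<^esub> x) p \<noteq> \<zero>} \<subseteq> T"
      using r by (auto simp: T_def free_module_simps)
    have "linear_extension R M f (r \<odot>\<^bsub>?F\<^esub> x) = (\<Oplus>\<^bsub>M\<^esub>p\<in>T. (r \<odot>\<^bsub>?F\<^esub> x) p \<odot>\<^bsub>M\<^esub> f p)"
      by (rule linear_extension_eq_finsum[OF f F.smult_closed[OF r x] T(1) T' T(2)])
    also have "\<dots> = (\<Oplus>\<^bsub>M\<^esub>p\<in>T. r \<odot>\<^bsub>M\<^esub> (x p \<odot>\<^bsub>M\<^esub> f p))"
      using r T(2) by (intro M.finsum_cong' refl)
        (auto simp: free_module_simps closed[OF x] f_closed smult_assoc1)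
    also have "\<dots> = r \<odot>\<^bsub>M\<^esub> linear_extension R M f x"
      unfolding linear_extension_eq_finsum[OF f x T(1) T(3) T(2)]
      using r T(1,2) by (intro finsum_smult_ldistr[symmetric]) (auto simp: closed[OF x] f_closed)
    finally show ?thesis .
  qed
qed

lemma linear_extension_free_gen:
  assumes f: "f \<in> S \<rightarrow> carrier M" and s: "s \<in> S"
  shows "linear_extension R M f (free_gen R s) = f s"
proof -
  have fs: "f s \<in> carrier M" using f s by auto
  have "linear_extension R M f (free_gen R s) = (\<Oplus>\<^bsub>M\<^esub>p\<in>{s}. free_gen R s p \<odot>\<^bsub>M\<^esub> f p)"
    using s by (intro linear_extension_eq_finsum[OF f R.free_gen_in_free_module])
      (auto simp: free_gen_def)
  also have "\<dots> = f s"
    using fs by (subst M.finsum_insert) (auto simp: free_gen_def)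
  finally show ?thesis .
qed

end


section \<open>The universal property of the tensor product\<close>

text \<open>Kernels supply the submodules to which minimality of the hull
  \<open>tensor_kernel\<close> is applied.\<close>

lemma submodule_kernel:
  assumes "module K M" "module K N" "f \<in> linear_maps K M N"
  shows "submodule {x \<in> carrier M. f x = \<zero>\<^bsub>N\<^esub>} K M"
proof -
  interpret M: module K M by fact
  interpret N: module K N by fact
  show ?thesis
    by (rule M.submoduleI)
      (auto simp: linear_maps_zero[OF assms] linear_maps_minus[OF assms] linear_mapsD[OF assms(3)])
qed

text \<open>A hull is an intersection of submodules. The family must be nonempty, as the empty
  intersection is the whole type and not a part of the carrier.\<close>

lemma (in module) submodule_Inter:
  assumes "\<And>H. H \<in> \<H> \<Longrightarrow> submodule H R M" "\<H> \<noteq> {}"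
  shows "submodule (\<Inter>\<H>) R M"
proof (rule submoduleI)
  note E = submoduleE[OF assms(1)]
  show "\<Inter>\<H> \<subseteq> carrier M" using E(1) assms(2) by auto
  show "\<zero>\<^bsub>M\<^esub> \<in> \<Inter>\<H>" using subgroup.one_closed[OF submodule.axioms(1)[OF assms(1)]] by auto
qed (auto intro: submoduleE[OF assms(1)])

locale tensor_product = A: module K A + B: module K B
  for K (structure) and A :: "('k, 'a, 'd) module_scheme" and B :: "('k, 'b, 'e) module_scheme"
begin

abbreviation F where "F \<equiv> tensor_free K A B"

abbreviation N where "N \<equiv> tensor_kernel K A B"

sublocale F: module K F
  unfolding tensor_free_def by (rule A.R.free_module)

lemma gen_closed: "a \<in> carrier A \<Longrightarrow> b \<in> carrier B \<Longrightarrow> free_gen K (a, b) \<in> carrier F"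
  unfolding tensor_free_def by (simp add: A.R.free_gen_in_free_module)

lemma tensor_relators_closed: "tensor_relators K A B \<subseteq> carrier F"
  by (auto simp: tensor_relators_def Let_def gen_closed)

text \<open>The family that defines the hull is nonempty because the full carrier of
  \<open>F\<close> is a submodule containing all relators.\<close>

lemma tensor_kernel_submodule: "submodule N K F"
  unfolding tensor_kernel_def hull_def
  using F.carrier_is_submodule tensor_relators_closed by (intro F.submodule_Inter) auto

lemma tensor_relators_kernel: "tensor_relators K A B \<subseteq> N"
  unfolding tensor_kernel_def by (rule hull_subset)

lemma module_tensor: "module K (A \<boxtimes>\<^bsub>K\<^esub> B)"
  unfolding tensor_def by (rule F.quot_module[OF tensor_kernel_submodule])

text \<open>The four families of relators are exactly the four identities of bilinearity, and cosets
  agree as soon as the difference of their representatives is a relator.\<close>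

lemma pure_bilinear: "pure K A B \<in> bilinear_maps K A B (A \<boxtimes>\<^bsub>K\<^esub> B)"
proof -
  note q = F.quot_module_carrier[OF tensor_kernel_submodule]
    F.quot_module_add[OF tensor_kernel_submodule]
    F.quot_module_smult[OF tensor_kernel_submodule]
  have eq: "N +>\<^bsub>F\<^esub> x = N +>\<^bsub>F\<^esub> y"
    if "x \<ominus>\<^bsub>F\<^esub> y \<in> tensor_relators K A B" "x \<in> carrier F" "y \<in> carrier F" for x y
    using F.coset_eq_iff[OF tensor_kernel_submodule that(2,3)] that(1) tensor_relators_kernel by auto
  have closed: "pure K A B a b \<in> carrier (A \<boxtimes>\<^bsub>K\<^esub> B)" if "a \<in> carrier A" "b \<in> carrier B" for a b
    using gen_closed[OF that] by (auto simp: pure_def tensor_def q)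
  show ?thesis
  proof (intro bilinear_mapsI linear_mapsI closed)
    show "pure K A B a (b \<oplus>\<^bsub>B\<^esub> b') = pure K A B a b \<oplus>\<^bsub>A \<boxtimes>\<^bsub>K\<^esub> B\<^esub> pure K A B a b'"
      if "a \<in> carrier A" "b \<in> carrier B" "b' \<in> carrier B" for a b b'
      unfolding pure_def tensor_def using that
      by (simp add: q gen_closed, intro eq) (auto simp: gen_closed tensor_relators_def Let_def)
    show "pure K A B (a \<oplus>\<^bsub>A\<^esub> a') b = pure K A B a b \<oplus>\<^bsub>A \<boxtimes>\<^bsub>K\<^esub> B\<^esub> pure K A B a' b"
      if "b \<in> carrier B" "a \<in> carrier A" "a' \<in> carrier A" for b a a'
      unfolding pure_def tensor_def using that
      by (simp add: q gen_closed, intro eq) (auto simp: gen_closed tensor_relators_def Let_def)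
    show "pure K A B a (r \<odot>\<^bsub>B\<^esub> b) = r \<odot>\<^bsub>A \<boxtimes>\<^bsub>K\<^esub> B\<^esub> pure K A B a b"
      if "a \<in> carrier A" "r \<in> carrier K" "b \<in> carrier B" for a r b
      unfolding pure_def tensor_def using that
      by (simp add: q gen_closed, intro eq) (auto simp: gen_closed tensor_relators_def Let_def)
    show "pure K A B (r \<odot>\<^bsub>A\<^esub> a) b = r \<odot>\<^bsub>A \<boxtimes>\<^bsub>K\<^esub> B\<^esub> pure K A B a b"
      if "b \<in> carrier B" "r \<in> carrier K" "a \<in> carrier A" for b r a
      unfolding pure_def tensor_def using that
      by (simp add: q gen_closed, intro eq) (auto simp: gen_closed tensor_relators_def Let_def)
  qed
qed

lemmas pure_closed = bilinear_maps_closed[OF pure_bilinear]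

text \<open>Neither zero nor scalar multiples need a case of their own: zero is the pure tensor of
  two zeros, and a scalar can be absorbed into the first factor of a pure tensor. The proof lifts
  induction on the free module to cosets.\<close>

lemma tensor_induct [consumes 1, case_names pure add]:
  assumes t: "t \<in> carrier (A \<boxtimes>\<^bsub>K\<^esub> B)"
    and pure: "\<And>a b. a \<in> carrier A \<Longrightarrow> b \<in> carrier B \<Longrightarrow> P (pure K A B a b)"
    and add: "\<And>x y. x \<in> carrier (A \<boxtimes>\<^bsub>K\<^esub> B) \<Longrightarrow> y \<in> carrier (A \<boxtimes>\<^bsub>K\<^esub> B) \<Longrightarrow> P x \<Longrightarrow> P y \<Longrightarrow>
      P (x \<oplus>\<^bsub>A \<boxtimes>\<^bsub>K\<^esub> B\<^esub> y)"
  shows "P t"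
proof -
  interpret T: module K "A \<boxtimes>\<^bsub>K\<^esub> B" by (rule module_tensor)
  note S = tensor_kernel_submodule
  obtain x where x: "x \<in> carrier F" and tx: "t = N +>\<^bsub>F\<^esub> x"
    using t by (auto simp: tensor_def F.quot_module_carrier[OF S])
  from x have "P (N +>\<^bsub>F\<^esub> x)"
    unfolding tensor_free_def
  proof (induction x rule: A.R.free_module_induct)
    case zero
    have "pure K A B \<zero>\<^bsub>A\<^esub> \<zero>\<^bsub>B\<^esub> = \<zero>\<^bsub>A \<boxtimes>\<^bsub>K\<^esub> B\<^esub>"
      by (rule linear_maps_zero[OF _ _ bilinear_mapsD(1)[OF pure_bilinear]])
        (auto intro: module_tensor A.module_axioms B.module_axioms)
    then have "P \<zero>\<^bsub>A \<boxtimes>\<^bsub>K\<^esub> B\<^esub>" using pure[of "\<zero>\<^bsub>A\<^esub>" "\<zero>\<^bsub>B\<^esub>"] by simp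
    then show ?case
      by (simp add: tensor_def F.quot_module_zero[OF S] flip: tensor_free_def)
  next
    case (gen r s)
    obtain a b where s: "s = (a, b)" "a \<in> carrier A" "b \<in> carrier B" using gen by auto
    have "N +>\<^bsub>F\<^esub> (r \<odot>\<^bsub>F\<^esub> free_gen K s) = r \<odot>\<^bsub>A \<boxtimes>\<^bsub>K\<^esub> B\<^esub> pure K A B a b"
      using gen s gen_closed by (simp add: pure_def tensor_def F.quot_module_smult[OF S])
    also have "\<dots> = pure K A B (r \<odot>\<^bsub>A\<^esub> a) b"
      using gen(1) s by (simp add: linear_mapsD(3)[OF bilinear_mapsD(2)[OF pure_bilinear]])
    finally show ?case
      using pure[of "r \<odot>\<^bsub>A\<^esub> a" b] gen(1) s by (simp flip: tensor_free_def)
  next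
    case (add f g)
    have "(N +>\<^bsub>F\<^esub> f) \<oplus>\<^bsub>A \<boxtimes>\<^bsub>K\<^esub> B\<^esub> (N +>\<^bsub>F\<^esub> g) = N +>\<^bsub>F\<^esub> (f \<oplus>\<^bsub>F\<^esub> g)"
      using add(1,2) unfolding tensor_def
      by (intro F.quot_module_add[OF S]) (simp_all add: tensor_free_def)
    moreover have "N +>\<^bsub>F\<^esub> f \<in> carrier (A \<boxtimes>\<^bsub>K\<^esub> B)" "N +>\<^bsub>F\<^esub> g \<in> carrier (A \<boxtimes>\<^bsub>K\<^esub> B)"
      using add(1,2) unfolding tensor_def by (simp_all add: F.quot_module_carrier[OF S] flip: tensor_free_def)
    ultimately show ?case
      using assms(3)[of "N +>\<^bsub>F\<^esub> f" "N +>\<^bsub>F\<^esub> g"] add(3,4) by (simp flip: tensor_free_def)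
  qed
  then show ?thesis using tx by simp
qed

lemma tensor_ext:
  assumes "f \<in> linear_maps K (A \<boxtimes>\<^bsub>K\<^esub> B) M" "g \<in> linear_maps K (A \<boxtimes>\<^bsub>K\<^esub> B) M"
    and "\<And>a b. a \<in> carrier A \<Longrightarrow> b \<in> carrier B \<Longrightarrow> f (pure K A B a b) = g (pure K A B a b)"
    and "t \<in> carrier (A \<boxtimes>\<^bsub>K\<^esub> B)"
  shows "f t = g t"
  using assms(4)
  by (induction rule: tensor_induct)
    (simp_all add: assms(3) linear_mapsD[OF assms(1)] linear_mapsD[OF assms(2)])

context
  fixes M :: "('k, 'm, 'f) module_scheme" and f :: "'a \<Rightarrow> 'b \<Rightarrow> 'm"
  assumes M: "module K M" and f: "f \<in> bilinear_maps K A B M"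
begin

interpretation M: module K M by (rule M)

abbreviation (input) lin where "lin \<equiv> linear_extension K M (\<lambda>p. f (fst p) (snd p))"

lemma uncurry_Pi: "(\<lambda>p. f (fst p) (snd p)) \<in> carrier A \<times> carrier B \<rightarrow> carrier M"
  using bilinear_maps_closed[OF f] by auto

lemma linear_extension_uncurry_linear: "lin \<in> linear_maps K F M"
  unfolding tensor_free_def by (rule M.linear_extension_linear[OF uncurry_Pi])

lemma linear_extension_uncurry_gen: "a \<in> carrier A \<Longrightarrow> b \<in> carrier B \<Longrightarrow> lin (free_gen K (a, b)) = f a b"
  by (subst M.linear_extension_free_gen[OF uncurry_Pi]) auto

text \<open>Bilinearity of \<open>f\<close> makes \<open>lin\<close> vanish on every relator. Its
  kernel is a submodule, so it contains the smallest submodule around the relators.\<close>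

lemma linear_extension_uncurry_kernel: "N \<subseteq> {x \<in> carrier F. lin x = \<zero>\<^bsub>M\<^esub>}"
proof -
  have "tensor_relators K A B \<subseteq> {x \<in> carrier F. lin x = \<zero>\<^bsub>M\<^esub>}"
    using tensor_relators_closed
    by (auto simp: tensor_relators_def Let_def linear_extension_uncurry_gen gen_closed a_minus_def
        linear_mapsD[OF linear_extension_uncurry_linear] linear_maps_minus[OF F.module_axioms M linear_extension_uncurry_linear]
        linear_mapsD[OF bilinear_mapsD(1)[OF f]] linear_mapsD[OF bilinear_mapsD(2)[OF f]] M.M.r_neg)
  then show ?thesis
    unfolding tensor_kernel_def
    by (rule hull_minimal) (rule submodule_kernel[OF F.module_axioms M linear_extension_uncurry_linear])
qed

text \<open>This removes the choice operator from \<open>tensor_lift\<close>: the representative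
  picked by \<open>SOME\<close> differs from \<open>x\<close> by an element of \<open>N\<close>,
  which \<open>lin\<close> annihilates.\<close>

lemma tensor_lift_coset:
  assumes x: "x \<in> carrier F"
  shows "tensor_lift K M f (N +>\<^bsub>F\<^esub> x) = lin x"
proof -
  interpret S: abelian_subgroup N F by (rule F.submodule_abelian_subgroup[OF tensor_kernel_submodule])
  define y where "y = (SOME y. y \<in> N +>\<^bsub>F\<^esub> x)"
  have y: "y \<in> N +>\<^bsub>F\<^esub> x" unfolding y_def by (rule someI[of "\<lambda>y. y \<in> N +>\<^bsub>F\<^esub> x", OF S.a_rcos_self[OF x]])
  then obtain n where n: "n \<in> N" "y = n \<oplus>\<^bsub>F\<^esub> x" by (auto simp: a_r_coset_def')
  have "tensor_lift K M f (N +>\<^bsub>F\<^esub> x) = lin y"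
    by (simp add: tensor_lift_def Let_def linear_extension_def flip: y_def)
  also have "\<dots> = lin x"
    using n linear_extension_uncurry_kernel x by (auto simp: linear_mapsD[OF linear_extension_uncurry_linear])
  finally show ?thesis .
qed

lemma tensor_lift_linear: "tensor_lift K M f \<in> linear_maps K (A \<boxtimes>\<^bsub>K\<^esub> B) M"
  unfolding tensor_def
  by (rule linear_mapsI)
    (auto simp: F.quot_module_carrier[OF tensor_kernel_submodule]
      F.quot_module_add[OF tensor_kernel_submodule] F.quot_module_smult[OF tensor_kernel_submodule]
      tensor_lift_coset linear_mapsD[OF linear_extension_uncurry_linear])

lemma tensor_lift_pure:
  "a \<in> carrier A \<Longrightarrow> b \<in> carrier B \<Longrightarrow> tensor_lift K M f (pure K A B a b) = f a b"
  by (simp add: pure_def tensor_lift_coset gen_closed linear_extension_uncurry_gen)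

end

end

lemmas module_tensor = tensor_product.module_tensor[OF tensor_product.intro]
  and pure_bilinear = tensor_product.pure_bilinear[OF tensor_product.intro]
  and pure_closed = tensor_product.pure_closed[OF tensor_product.intro]
  and tensor_ext = tensor_product.tensor_ext[OF tensor_product.intro]
  and tensor_lift_linear = tensor_product.tensor_lift_linear[OF tensor_product.intro]
  and tensor_lift_pure = tensor_product.tensor_lift_pure[OF tensor_product.intro]

text \<open>The associativity maps are lifts nested in lifts, and the outer one requires the inner
  one to be linear in the parameter that it carries along. For fixed parameters both sides of each
  identity are linear in \<open>t\<close>, so pure \<open>t\<close> suffice, and there the claim is
  linearity of \<open>g\<close> in \<open>p\<close>.\<close>

lemma tensor_lift_linear_param:
  assumes A: "module K A" and B: "module K B" and P: "module K P" and M: "module K M"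
    and g: "\<And>p. p \<in> carrier P \<Longrightarrow> g p \<in> bilinear_maps K A B M"
      "\<And>a b. a \<in> carrier A \<Longrightarrow> b \<in> carrier B \<Longrightarrow> (\<lambda>p. g p a b) \<in> linear_maps K P M"
    and t: "t \<in> carrier (A \<boxtimes>\<^bsub>K\<^esub> B)"
  shows "(\<lambda>p. tensor_lift K M (g p) t) \<in> linear_maps K P M"
proof (rule linear_mapsI)
  interpret P: module K P by (rule P)
  note lift = tensor_lift_linear[OF A B M g(1)] and lift_pure = tensor_lift_pure[OF A B M g(1)]
  show "tensor_lift K M (g p) t \<in> carrier M" if "p \<in> carrier P" for p
    by (rule linear_mapsD(1)[OF lift[OF that] t])
  show "tensor_lift K M (g (p \<oplus>\<^bsub>P\<^esub> q)) t = tensor_lift K M (g p) t \<oplus>\<^bsub>M\<^esub> tensor_lift K M (g q) t"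
    if pq: "p \<in> carrier P" "q \<in> carrier P" for p q
  proof (rule tensor_ext[OF A B lift linear_maps_add[OF M lift lift] _ t])
    show "tensor_lift K M (g (p \<oplus>\<^bsub>P\<^esub> q)) (pure K A B a b) =
        tensor_lift K M (g p) (pure K A B a b) \<oplus>\<^bsub>M\<^esub> tensor_lift K M (g q) (pure K A B a b)"
      if "a \<in> carrier A" "b \<in> carrier B" for a b
      using that pq by (simp add: lift_pure linear_mapsD(2)[OF g(2)])
  qed (use pq in simp_all)
  show "tensor_lift K M (g (r \<odot>\<^bsub>P\<^esub> p)) t = r \<odot>\<^bsub>M\<^esub> tensor_lift K M (g p) t"
    if r: "r \<in> carrier K" and p: "p \<in> carrier P" for r p
  proof (rule tensor_ext[OF A B lift linear_maps_smult[OF M lift r] _ t])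
    show "tensor_lift K M (g (r \<odot>\<^bsub>P\<^esub> p)) (pure K A B a b) = r \<odot>\<^bsub>M\<^esub> tensor_lift K M (g p) (pure K A B a b)"
      if "a \<in> carrier A" "b \<in> carrier B" for a b
      using that r p by (simp add: lift_pure linear_mapsD(3)[OF g(2)])
  qed (use r p in simp_all)
qed


section \<open>Canonical maps between tensor products\<close>

context
  fixes K :: "('k, 'c) ring_scheme"
    and A :: "('k, 'a, 'd) module_scheme" and B :: "('k, 'b, 'e) module_scheme"
    and M :: "('k, 'm, 'f) module_scheme" and N :: "('k, 'n, 'g) module_scheme"
    and f :: "'a \<Rightarrow> 'm" and g :: "'b \<Rightarrow> 'n"
  assumes mods: "module K A" "module K B" "module K M" "module K N"
    and f: "f \<in> linear_maps K A M" and g: "g \<in> linear_maps K B N"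
begin

lemma pure_map_bilinear: "(\<lambda>a b. pure K M N (f a) (g b)) \<in> bilinear_maps K A B (M \<boxtimes>\<^bsub>K\<^esub> N)"
  by (rule bilinear_maps_compose[OF pure_bilinear[OF mods(3,4)] f g])

lemma tensor_map_linear: "tensor_map K M N f g \<in> linear_maps K (A \<boxtimes>\<^bsub>K\<^esub> B) (M \<boxtimes>\<^bsub>K\<^esub> N)"
  unfolding tensor_map_def
  by (rule tensor_lift_linear[OF mods(1,2) module_tensor[OF mods(3,4)] pure_map_bilinear])

lemma tensor_map_pure:
  "a \<in> carrier A \<Longrightarrow> b \<in> carrier B \<Longrightarrow> tensor_map K M N f g (pure K A B a b) = pure K M N (f a) (g b)"
  unfolding tensor_map_def
  by (rule tensor_lift_pure[OF mods(1,2) module_tensor[OF mods(3,4)] pure_map_bilinear])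

end

context
  fixes K :: "('k, 'c) ring_scheme"
    and A :: "('k, 'x, 'd) module_scheme" and B :: "('k, 'y, 'e) module_scheme"
    and C :: "('k, 'z, 'f) module_scheme"
  assumes A: "module K A" and B: "module K B" and C: "module K C"
begin

lemma tensor_assoc_inner_bilinear:
  assumes "c \<in> carrier C"
  shows "(\<lambda>a b. pure K A (B \<boxtimes>\<^bsub>K\<^esub> C) a (pure K B C b c)) \<in> bilinear_maps K A B (A \<boxtimes>\<^bsub>K\<^esub> (B \<boxtimes>\<^bsub>K\<^esub> C))"
  using bilinear_maps_compose[OF pure_bilinear[OF A module_tensor[OF B C]] linear_maps_id
      bilinear_mapsD(2)[OF pure_bilinear[OF B C] assms]]
  by simp

text \<open>Linearity in \<open>t\<close> is that of a lift, and linearity in \<open>c\<close> is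
  the case of a lift that depends on a parameter.\<close>

lemma tensor_assoc_outer_bilinear:
  "(\<lambda>t c. tensor_lift K (A \<boxtimes>\<^bsub>K\<^esub> (B \<boxtimes>\<^bsub>K\<^esub> C))
      (\<lambda>a b. pure K A (B \<boxtimes>\<^bsub>K\<^esub> C) a (pure K B C b c)) t)
    \<in> bilinear_maps K (A \<boxtimes>\<^bsub>K\<^esub> B) C (A \<boxtimes>\<^bsub>K\<^esub> (B \<boxtimes>\<^bsub>K\<^esub> C))"
proof (rule bilinear_mapsI)
  note BC = module_tensor[OF B C]
  note T = module_tensor[OF A BC]
  show "(\<lambda>c. tensor_lift K (A \<boxtimes>\<^bsub>K\<^esub> (B \<boxtimes>\<^bsub>K\<^esub> C))
      (\<lambda>a b. pure K A (B \<boxtimes>\<^bsub>K\<^esub> C) a (pure K B C b c)) t) \<in> linear_maps K C (A \<boxtimes>\<^bsub>K\<^esub> (B \<boxtimes>\<^bsub>K\<^esub> C))"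
    if "t \<in> carrier (A \<boxtimes>\<^bsub>K\<^esub> B)" for t
    by (rule tensor_lift_linear_param[OF A B C T tensor_assoc_inner_bilinear
          linear_maps_compose[OF bilinear_mapsD(1)[OF pure_bilinear[OF A BC]]
            bilinear_mapsD(1)[OF pure_bilinear[OF B C]]] that])
  show "tensor_lift K (A \<boxtimes>\<^bsub>K\<^esub> (B \<boxtimes>\<^bsub>K\<^esub> C))
      (\<lambda>a b. pure K A (B \<boxtimes>\<^bsub>K\<^esub> C) a (pure K B C b c))
      \<in> linear_maps K (A \<boxtimes>\<^bsub>K\<^esub> B) (A \<boxtimes>\<^bsub>K\<^esub> (B \<boxtimes>\<^bsub>K\<^esub> C))" if "c \<in> carrier C" for c
    by (rule tensor_lift_linear[OF A B T tensor_assoc_inner_bilinear[OF that]])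
qed

lemma tensor_assoc_linear:
  "tensor_assoc K A B C \<in> linear_maps K (A \<boxtimes>\<^bsub>K\<^esub> B \<boxtimes>\<^bsub>K\<^esub> C) (A \<boxtimes>\<^bsub>K\<^esub> (B \<boxtimes>\<^bsub>K\<^esub> C))"
  unfolding tensor_assoc_def Let_def
  by (intro tensor_lift_linear tensor_assoc_outer_bilinear module_tensor A B C)

lemma tensor_assoc_pure:
  assumes "a \<in> carrier A" "b \<in> carrier B" "c \<in> carrier C"
  shows "tensor_assoc K A B C (pure K (A \<boxtimes>\<^bsub>K\<^esub> B) C (pure K A B a b) c) =
    pure K A (B \<boxtimes>\<^bsub>K\<^esub> C) a (pure K B C b c)"
  unfolding tensor_assoc_def Let_def
  using assms
  by (simp add: tensor_lift_pure[OF _ _ _ tensor_assoc_outer_bilinear]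
      tensor_lift_pure[OF _ _ _ tensor_assoc_inner_bilinear] pure_closed module_tensor A B C)

lemma tensor_assoc_inv_inner_bilinear:
  assumes "a \<in> carrier A"
  shows "(\<lambda>b c. pure K (A \<boxtimes>\<^bsub>K\<^esub> B) C (pure K A B a b) c) \<in> bilinear_maps K B C (A \<boxtimes>\<^bsub>K\<^esub> B \<boxtimes>\<^bsub>K\<^esub> C)"
  using bilinear_maps_compose[OF pure_bilinear[OF module_tensor[OF A B] C]
      bilinear_mapsD(1)[OF pure_bilinear[OF A B] assms] linear_maps_id]
  by simp

lemma tensor_assoc_inv_outer_bilinear:
  "(\<lambda>a t. tensor_lift K (A \<boxtimes>\<^bsub>K\<^esub> B \<boxtimes>\<^bsub>K\<^esub> C)
      (\<lambda>b c. pure K (A \<boxtimes>\<^bsub>K\<^esub> B) C (pure K A B a b) c) t)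
    \<in> bilinear_maps K A (B \<boxtimes>\<^bsub>K\<^esub> C) (A \<boxtimes>\<^bsub>K\<^esub> B \<boxtimes>\<^bsub>K\<^esub> C)"
proof (rule bilinear_mapsI)
  note AB = module_tensor[OF A B]
  note T = module_tensor[OF AB C]
  show "(\<lambda>a. tensor_lift K (A \<boxtimes>\<^bsub>K\<^esub> B \<boxtimes>\<^bsub>K\<^esub> C)
      (\<lambda>b c. pure K (A \<boxtimes>\<^bsub>K\<^esub> B) C (pure K A B a b) c) t) \<in> linear_maps K A (A \<boxtimes>\<^bsub>K\<^esub> B \<boxtimes>\<^bsub>K\<^esub> C)"
    if "t \<in> carrier (B \<boxtimes>\<^bsub>K\<^esub> C)" for t
    by (rule tensor_lift_linear_param[OF B C A T tensor_assoc_inv_inner_bilinear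
          linear_maps_compose[OF bilinear_mapsD(2)[OF pure_bilinear[OF AB C]]
            bilinear_mapsD(2)[OF pure_bilinear[OF A B]]] that])
  show "tensor_lift K (A \<boxtimes>\<^bsub>K\<^esub> B \<boxtimes>\<^bsub>K\<^esub> C) (\<lambda>b c. pure K (A \<boxtimes>\<^bsub>K\<^esub> B) C (pure K A B a b) c)
      \<in> linear_maps K (B \<boxtimes>\<^bsub>K\<^esub> C) (A \<boxtimes>\<^bsub>K\<^esub> B \<boxtimes>\<^bsub>K\<^esub> C)" if "a \<in> carrier A" for a
    by (rule tensor_lift_linear[OF B C T tensor_assoc_inv_inner_bilinear[OF that]])
qed

lemma tensor_assoc_inv_linear:
  "tensor_assoc_inv K A B C \<in> linear_maps K (A \<boxtimes>\<^bsub>K\<^esub> (B \<boxtimes>\<^bsub>K\<^esub> C)) (A \<boxtimes>\<^bsub>K\<^esub> B \<boxtimes>\<^bsub>K\<^esub> C)"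
  unfolding tensor_assoc_inv_def Let_def
  by (intro tensor_lift_linear tensor_assoc_inv_outer_bilinear module_tensor A B C)

lemma tensor_assoc_inv_pure:
  assumes "a \<in> carrier A" "b \<in> carrier B" "c \<in> carrier C"
  shows "tensor_assoc_inv K A B C (pure K A (B \<boxtimes>\<^bsub>K\<^esub> C) a (pure K B C b c)) =
    pure K (A \<boxtimes>\<^bsub>K\<^esub> B) C (pure K A B a b) c"
  unfolding tensor_assoc_inv_def Let_def
  using assms
  by (simp add: tensor_lift_pure[OF _ _ _ tensor_assoc_inv_outer_bilinear]
      tensor_lift_pure[OF _ _ _ tensor_assoc_inv_inner_bilinear] pure_closed module_tensor A B C)

end

context
  fixes K :: "('k, 'c) ring_scheme" and A :: "('k, 'a, 'd) module_scheme"
    and M :: "('k, 'm, 'e) module_scheme" and N :: "('k, 'n, 'f) module_scheme"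
    and P :: "('k, 'p, 'g) module_scheme" and Q :: "('k, 'q, 'h) module_scheme"
    and f :: "('m \<times> 'n \<Rightarrow> 'k) set \<Rightarrow> ('p \<times> 'q \<Rightarrow> 'k) set"
  assumes mods: "module K A" "module K M" "module K N" "module K P" "module K Q"
    and f: "f \<in> linear_maps K (M \<boxtimes>\<^bsub>K\<^esub> N) (P \<boxtimes>\<^bsub>K\<^esub> Q)"
begin

lemma tensor_map23_linear:
  "tensor_map23 K A M N P Q f \<in> linear_maps K (A \<boxtimes>\<^bsub>K\<^esub> M \<boxtimes>\<^bsub>K\<^esub> N) (A \<boxtimes>\<^bsub>K\<^esub> P \<boxtimes>\<^bsub>K\<^esub> Q)"
  unfolding tensor_map23_def comp_def
  by (intro linear_maps_compose[OF linear_maps_compose[OF tensor_assoc_inv_linear tensor_map_linear]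
        tensor_assoc_linear] module_tensor mods linear_maps_id f)

text \<open>The evaluation stops in front of \<open>tensor_assoc_inv\<close>, since \<open>f\<close>
  need not return a pure tensor.\<close>

lemma tensor_map23_pure:
  assumes "a \<in> carrier A" "m \<in> carrier M" "n \<in> carrier N"
  shows "tensor_map23 K A M N P Q f (pure K (A \<boxtimes>\<^bsub>K\<^esub> M) N (pure K A M a m) n) =
    tensor_assoc_inv K A P Q (pure K A (P \<boxtimes>\<^bsub>K\<^esub> Q) a (f (pure K M N m n)))"
  using assms
  by (simp add: tensor_map23_def tensor_assoc_pure tensor_map_pure[OF _ _ _ _ linear_maps_id f]
      mods module_tensor pure_closed)

end


section \<open>Twisted tensor products\<close>

text \<open>A twisted tensor product enters the second stage of the iterated product before it is known to be
  associative; bilinearity of the product is all that \<^const>\<open>mult_map\<close> needs.\<close>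

locale bilinear_algebra = module K A for K (structure) and A (structure) +
  assumes mult_bilinear: "mult A \<in> bilinear_maps K A A A"
    and unit_closed: "\<one>\<^bsub>A\<^esub> \<in> carrier A"

lemma (in assoc_algebra) bilinear_algebra: "bilinear_algebra K A"
  by (intro bilinear_algebra.intro bilinear_algebra_axioms.intro module_axioms one_closed
      assoc_algebra_bilinear_mult assoc_algebra_axioms)

context bilinear_algebra
begin

lemma mult_map_linear: "mult_map K A \<in> linear_maps K (A \<boxtimes>\<^bsub>K\<^esub> A) A"
  unfolding mult_map_def by (intro tensor_lift_linear module_axioms mult_bilinear)

lemma mult_map_pure:
  "x \<in> carrier A \<Longrightarrow> y \<in> carrier A \<Longrightarrow> mult_map K A (pure K A A x y) = x \<otimes>\<^bsub>A\<^esub> y"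
  unfolding mult_map_def by (intro tensor_lift_pure module_axioms mult_bilinear)

end

lemma twisted_tensor_simps:
  "carrier (twisted_tensor K A B R) = carrier (A \<boxtimes>\<^bsub>K\<^esub> B)"
  "x \<oplus>\<^bsub>twisted_tensor K A B R\<^esub> y = x \<oplus>\<^bsub>A \<boxtimes>\<^bsub>K\<^esub> B\<^esub> y"
  "\<zero>\<^bsub>twisted_tensor K A B R\<^esub> = \<zero>\<^bsub>A \<boxtimes>\<^bsub>K\<^esub> B\<^esub>"
  "r \<odot>\<^bsub>twisted_tensor K A B R\<^esub> x = r \<odot>\<^bsub>A \<boxtimes>\<^bsub>K\<^esub> B\<^esub> x"
  "\<one>\<^bsub>twisted_tensor K A B R\<^esub> = pure K A B \<one>\<^bsub>A\<^esub> \<one>\<^bsub>B\<^esub>"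
  "x \<otimes>\<^bsub>twisted_tensor K A B R\<^esub> y = twisted_mult_map K A B R (pure K (A \<boxtimes>\<^bsub>K\<^esub> B) (A \<boxtimes>\<^bsub>K\<^esub> B) x y)"
  by (simp_all add: twisted_tensor_def)

lemma linear_maps_twisted_tensor:
  "linear_maps K (twisted_tensor K A B R) M = linear_maps K (A \<boxtimes>\<^bsub>K\<^esub> B) M"
  "linear_maps K M (twisted_tensor K A B R) = linear_maps K M (A \<boxtimes>\<^bsub>K\<^esub> B)"
  by (simp_all add: linear_maps_def twisted_tensor_simps)

text \<open>The tensor product reads only the module fields of its factors, and twisting replaces
  only \<open>mult\<close> and \<open>one\<close>. The two sides are therefore equal as objects, and
  no isomorphism has to be transported.\<close>

lemma tensor_twisted_tensor:
  "twisted_tensor K A B R \<boxtimes>\<^bsub>K\<^esub> M = A \<boxtimes>\<^bsub>K\<^esub> B \<boxtimes>\<^bsub>K\<^esub> M"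
  "M \<boxtimes>\<^bsub>K\<^esub> twisted_tensor K A B R = M \<boxtimes>\<^bsub>K\<^esub> (A \<boxtimes>\<^bsub>K\<^esub> B)"
  "pure K (twisted_tensor K A B R) M = pure K (A \<boxtimes>\<^bsub>K\<^esub> B) M"
  "pure K M (twisted_tensor K A B R) = pure K M (A \<boxtimes>\<^bsub>K\<^esub> B)"
  by (simp_all add: tensor_def tensor_kernel_def tensor_relators_def tensor_free_def pure_def
      twisted_tensor_simps fun_eq_iff)

lemma module_twisted_tensor:
  assumes "module K A" "module K B"
  shows "module K (twisted_tensor K A B R)"
proof -
  interpret T: module K "A \<boxtimes>\<^bsub>K\<^esub> B" by (rule module_tensor[OF assms])
  have "abelian_group (twisted_tensor K A B R)"
    by (rule abelian_groupI)
      (auto simp: twisted_tensor_simps T.M.a_ac intro: abelian_groupE(6)[OF T.M.abelian_group_axioms])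
  then show ?thesis
    by (intro moduleI T.R.is_cring)
      (simp_all add: twisted_tensor_simps T.smult_l_distr T.smult_r_distr T.smult_assoc1)
qed

context
  fixes K :: "('k, 'c) ring_scheme"
    and A :: "('k, 'a, 'd) module_scheme" and B :: "('k, 'b, 'e) module_scheme"
    and R :: "('b \<times> 'a \<Rightarrow> 'k) set \<Rightarrow> ('a \<times> 'b \<Rightarrow> 'k) set"
  assumes A: "bilinear_algebra K A" and B: "bilinear_algebra K B"
    and R: "R \<in> linear_maps K (B \<boxtimes>\<^bsub>K\<^esub> A) (A \<boxtimes>\<^bsub>K\<^esub> B)"
begin

interpretation A: bilinear_algebra K A by (rule A)
interpretation B: bilinear_algebra K B by (rule B)

lemmas twisted_factor_modules = A.module_axioms B.module_axioms

lemma twisted_mult_map_linear: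
  "twisted_mult_map K A B R \<in> linear_maps K ((A \<boxtimes>\<^bsub>K\<^esub> B) \<boxtimes>\<^bsub>K\<^esub> (A \<boxtimes>\<^bsub>K\<^esub> B)) (A \<boxtimes>\<^bsub>K\<^esub> B)"
  unfolding twisted_mult_map_def comp_def
  by (intro linear_maps_compose[OF linear_maps_compose[OF linear_maps_compose[OF
          tensor_map_linear tensor_assoc_linear] tensor_map_linear] tensor_assoc_inv_linear]
      tensor_map23_linear A.mult_map_linear B.mult_map_linear linear_maps_id module_tensor twisted_factor_modules R)

text \<open>In words of elements: apply \<open>R\<close> to the two inner factors \<open>b\<close>
  and \<open>a'\<close>, then multiply the result by \<open>a\<close> on the left and by
  \<open>b'\<close> on the right.\<close>

lemma twisted_mult_map_pure:
  assumes ab: "a \<in> carrier A" "b \<in> carrier B" "a' \<in> carrier A" "b' \<in> carrier B"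
  shows "twisted_mult_map K A B R (pure K (A \<boxtimes>\<^bsub>K\<^esub> B) (A \<boxtimes>\<^bsub>K\<^esub> B) (pure K A B a b) (pure K A B a' b')) =
    tensor_map K A B (\<lambda>x. a \<otimes>\<^bsub>A\<^esub> x) (\<lambda>y. y \<otimes>\<^bsub>B\<^esub> b') (R (pure K B A b a'))"
proof -
  let ?m = "tensor_map K A B (mult_map K A) (mult_map K B)"
  let ?l = "tensor_map K A B (\<lambda>x. a \<otimes>\<^bsub>A\<^esub> x) (\<lambda>y. y \<otimes>\<^bsub>B\<^esub> b')"
  \<comment> \<open>\<open>?f\<close> is what remains of the product map once \<open>R\<close> has
    been applied, with the output of \<open>R\<close> abstracted to \<open>t\<close>. Being linear
    in \<open>t\<close>, it can be compared with \<open>?l\<close> on pure tensors.\<close>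
  let ?f = "\<lambda>t. ?m (tensor_assoc K (A \<boxtimes>\<^bsub>K\<^esub> A) B B
    (pure K (A \<boxtimes>\<^bsub>K\<^esub> A \<boxtimes>\<^bsub>K\<^esub> B) B (tensor_assoc_inv K A A B (pure K A (A \<boxtimes>\<^bsub>K\<^esub> B) a t)) b'))"
  have lin: "?f \<in> linear_maps K (A \<boxtimes>\<^bsub>K\<^esub> B) (A \<boxtimes>\<^bsub>K\<^esub> B)"
    by (intro linear_maps_compose[OF tensor_map_linear[where A = "A \<boxtimes>\<^bsub>K\<^esub> A" and B = "B \<boxtimes>\<^bsub>K\<^esub> B"]]
        linear_maps_compose[OF tensor_assoc_linear]
        linear_maps_compose[OF bilinear_mapsD(2)[OF pure_bilinear]]
        linear_maps_compose[OF tensor_assoc_inv_linear] bilinear_mapsD(1)[OF pure_bilinear]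
        A.mult_map_linear B.mult_map_linear module_tensor twisted_factor_modules ab)
  note l = bilinear_mapsD(1)[OF A.mult_bilinear ab(1)] bilinear_mapsD(2)[OF B.mult_bilinear ab(4)]
  have eq: "?f t = ?l t" if "t \<in> carrier (A \<boxtimes>\<^bsub>K\<^esub> B)" for t
  proof (rule tensor_ext[OF twisted_factor_modules lin tensor_map_linear[OF twisted_factor_modules twisted_factor_modules l] _ that])
    show "?f (pure K A B x y) = ?l (pure K A B x y)" if "x \<in> carrier A" "y \<in> carrier B" for x y
      using ab that
      by (simp add: tensor_assoc_inv_pure tensor_assoc_pure tensor_map_pure[OF twisted_factor_modules twisted_factor_modules l]
          tensor_map_pure[OF _ _ twisted_factor_modules A.mult_map_linear B.mult_map_linear] twisted_factor_modules module_tensor pure_closed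
          A.mult_map_pure B.mult_map_pure)
  qed
  have "twisted_mult_map K A B R (pure K (A \<boxtimes>\<^bsub>K\<^esub> B) (A \<boxtimes>\<^bsub>K\<^esub> B) (pure K A B a b) (pure K A B a' b')) =
    ?f (R (pure K B A b a'))"
    using ab
    by (simp add: twisted_mult_map_def tensor_assoc_inv_pure twisted_factor_modules module_tensor pure_closed
        tensor_map_pure[OF _ _ _ _ tensor_map23_linear[OF _ _ _ _ _ R] linear_maps_id]
        tensor_map23_pure[OF _ _ _ _ _ R])
  also have "\<dots> = ?l (R (pure K B A b a'))"
    using ab by (intro eq linear_mapsD(1)[OF R] pure_closed twisted_factor_modules)
  finally show ?thesis .
qed

lemma twisted_tensor_bilinear_algebra: "bilinear_algebra K (twisted_tensor K A B R)"
proof (intro bilinear_algebra.intro bilinear_algebra_axioms.intro module_twisted_tensor twisted_factor_modules)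
  have "(\<lambda>x y. twisted_mult_map K A B R (pure K (A \<boxtimes>\<^bsub>K\<^esub> B) (A \<boxtimes>\<^bsub>K\<^esub> B) x y))
      \<in> bilinear_maps K (A \<boxtimes>\<^bsub>K\<^esub> B) (A \<boxtimes>\<^bsub>K\<^esub> B) (A \<boxtimes>\<^bsub>K\<^esub> B)"
    by (intro linear_bilinear_compose[OF twisted_mult_map_linear] pure_bilinear module_tensor twisted_factor_modules)
  then show "mult (twisted_tensor K A B R)
      \<in> bilinear_maps K (twisted_tensor K A B R) (twisted_tensor K A B R) (twisted_tensor K A B R)"
    by (simp add: bilinear_maps_def linear_maps_twisted_tensor) (simp add: twisted_tensor_def)
  show "\<one>\<^bsub>twisted_tensor K A B R\<^esub> \<in> carrier (twisted_tensor K A B R)"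
    by (simp add: twisted_tensor_simps pure_closed twisted_factor_modules A.unit_closed B.unit_closed)
qed

end

lemma algebra_homsD:
  assumes "f \<in> algebra_homs K A X"
  shows "f \<in> linear_maps K A X"
    and "x \<in> carrier A \<Longrightarrow> y \<in> carrier A \<Longrightarrow> f (x \<otimes>\<^bsub>A\<^esub> y) = f x \<otimes>\<^bsub>X\<^esub> f y"
    and "f \<one>\<^bsub>A\<^esub> = \<one>\<^bsub>X\<^esub>"
    and "x \<in> carrier A \<Longrightarrow> f x \<in> carrier X"
  using assms by (auto simp: algebra_homs_def ring_hom_def linear_maps_def)

lemma algebra_homsI:
  assumes "f \<in> linear_maps K A X"
    and "\<And>x y. x \<in> carrier A \<Longrightarrow> y \<in> carrier A \<Longrightarrow> f (x \<otimes>\<^bsub>A\<^esub> y) = f x \<otimes>\<^bsub>X\<^esub> f y"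
    and "f \<one>\<^bsub>A\<^esub> = \<one>\<^bsub>X\<^esub>"
  shows "f \<in> algebra_homs K A X"
  using assms by (auto simp: algebra_homs_def ring_hom_def linear_maps_def)

text \<open>Products and the unit stay in the carrier, so the restricted map is evaluated only where
  it agrees with \<open>f\<close>.\<close>

lemma (in bilinear_algebra) algebra_homs_restrict:
  assumes "f \<in> algebra_homs K A X"
  shows "restrict f (carrier A) \<in> algebra_homs K A X"
  using linear_mapsD[OF algebra_homsD(1)[OF assms]] algebra_homsD[OF assms]
    bilinear_maps_closed[OF mult_bilinear] unit_closed
  by (intro algebra_homsI linear_mapsI) simp_all

text \<open>This is the product of \<open>X\<close> composed with the tensor product of
  \<open>f\<close> and \<open>g\<close>, encoded as a single lift so that one bilinearity check
  yields linearity and the values on pure tensors.\<close>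

definition hom_product ::
  "('k, 'c) ring_scheme \<Rightarrow> ('k, 'm, 'd) module_scheme \<Rightarrow> ('a \<Rightarrow> 'm) \<Rightarrow> ('b \<Rightarrow> 'm) \<Rightarrow>
    ('a \<times> 'b \<Rightarrow> 'k) set \<Rightarrow> 'm"
  where "hom_product K X f g = tensor_lift K X (\<lambda>a b. f a \<otimes>\<^bsub>X\<^esub> g b)"

context
  fixes K :: "('k, 'c) ring_scheme" and X :: "('k, 'm, 'g) module_scheme"
    and A :: "('k, 'a, 'd) module_scheme" and B :: "('k, 'b, 'e) module_scheme"
    and f :: "'a \<Rightarrow> 'm" and g :: "'b \<Rightarrow> 'm"
  assumes X: "assoc_algebra K X" and A: "module K A" and B: "module K B"
    and f: "f \<in> linear_maps K A X" and g: "g \<in> linear_maps K B X"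
begin

interpretation X: assoc_algebra K X by (rule X)

lemma hom_product_bilinear: "(\<lambda>a b. f a \<otimes>\<^bsub>X\<^esub> g b) \<in> bilinear_maps K A B X"
  by (rule bilinear_maps_compose[OF assoc_algebra_bilinear_mult[OF X] f g])

lemma hom_product_linear: "hom_product K X f g \<in> linear_maps K (A \<boxtimes>\<^bsub>K\<^esub> B) X"
  unfolding hom_product_def by (intro tensor_lift_linear A B X.module_axioms hom_product_bilinear)

lemma hom_product_pure:
  "a \<in> carrier A \<Longrightarrow> b \<in> carrier B \<Longrightarrow> hom_product K X f g (pure K A B a b) = f a \<otimes>\<^bsub>X\<^esub> g b"
  unfolding hom_product_def by (intro tensor_lift_pure A B X.module_axioms hom_product_bilinear)

end

lemma (in assoc_algebra)
  assumes "f \<in> linear_maps K M A" "x \<in> carrier A"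
  shows linear_maps_mult_left: "(\<lambda>t. x \<otimes>\<^bsub>A\<^esub> f t) \<in> linear_maps K M A"
    and linear_maps_mult_right: "(\<lambda>t. f t \<otimes>\<^bsub>A\<^esub> x) \<in> linear_maps K M A"
  by (rule linear_maps_compose[OF _ assms(1)],
      rule bilinear_mapsD[OF assoc_algebra_bilinear_mult[OF assoc_algebra_axioms] assms(2)])+

text \<open>Multiplicativity on pure tensors reduces to the crossing relation for \<open>g b \<otimes> f a'\<close> in
  \<open>f a \<otimes> (g b \<otimes> f a') \<otimes> g b'\<close>.\<close>

lemma hom_product_algebra_hom:
  assumes A: "bilinear_algebra K A" and B: "bilinear_algebra K B" and X: "assoc_algebra K X"
    and R: "R \<in> linear_maps K (B \<boxtimes>\<^bsub>K\<^esub> A) (A \<boxtimes>\<^bsub>K\<^esub> B)"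
    and f: "f \<in> algebra_homs K A X" and g: "g \<in> algebra_homs K B X"
    and cross: "\<And>a b. a \<in> carrier A \<Longrightarrow> b \<in> carrier B \<Longrightarrow>
      g b \<otimes>\<^bsub>X\<^esub> f a = hom_product K X f g (R (pure K B A b a))"
  shows "hom_product K X f g \<in> algebra_homs K (twisted_tensor K A B R) X"
proof -
  interpret A: bilinear_algebra K A by (rule A)
  interpret B: bilinear_algebra K B by (rule B)
  interpret X: assoc_algebra K X by (rule X)
  note AB = A.module_axioms B.module_axioms
  note fg = algebra_homsD(1)[OF f] algebra_homsD(1)[OF g]
  note fD = algebra_homsD[OF f] and gD = algebra_homsD[OF g]
  let ?h = "hom_product K X f g"
  let ?T = "A \<boxtimes>\<^bsub>K\<^esub> B"
  let ?m = "\<lambda>x y. twisted_mult_map K A B R (pure K ?T ?T x y)"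
  note lin = hom_product_linear[OF X AB fg] and h_pure = hom_product_pure[OF X AB fg]
  have bil1: "(\<lambda>x y. ?h (?m x y)) \<in> bilinear_maps K ?T ?T X"
    by (intro linear_bilinear_compose[OF lin] linear_bilinear_compose[OF twisted_mult_map_linear[OF A B R]]
        pure_bilinear module_tensor AB)
  have bil2: "(\<lambda>x y. ?h x \<otimes>\<^bsub>X\<^esub> ?h y) \<in> bilinear_maps K ?T ?T X"
    by (rule bilinear_maps_compose[OF assoc_algebra_bilinear_mult[OF X] lin lin])
  \<comment> \<open>Multiplicativity of \<open>f\<close> and \<open>g\<close> pulls the outer
    factors out of \<open>?h\<close>. The tensor \<open>t\<close> is arbitrary because it will be a
    value of \<open>R\<close>.\<close>
  have shift: "?h (tensor_map K A B (\<lambda>x. a \<otimes>\<^bsub>A\<^esub> x) (\<lambda>y. y \<otimes>\<^bsub>B\<^esub> b) t) = f a \<otimes>\<^bsub>X\<^esub> ?h t \<otimes>\<^bsub>X\<^esub> g b"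
    if ab: "a \<in> carrier A" "b \<in> carrier B" and t: "t \<in> carrier ?T" for a b t
  proof -
    note l = bilinear_mapsD(1)[OF A.mult_bilinear ab(1)] bilinear_mapsD(2)[OF B.mult_bilinear ab(2)]
    show ?thesis
    proof (rule tensor_ext[OF AB linear_maps_compose[OF lin tensor_map_linear[OF AB AB l]] _ _ t])
      show "(\<lambda>t. f a \<otimes>\<^bsub>X\<^esub> ?h t \<otimes>\<^bsub>X\<^esub> g b) \<in> linear_maps K ?T X"
        using ab by (intro X.linear_maps_mult_left X.linear_maps_mult_right lin fD(4) gD(4))
      show "?h (tensor_map K A B (\<lambda>x. a \<otimes>\<^bsub>A\<^esub> x) (\<lambda>y. y \<otimes>\<^bsub>B\<^esub> b) (pure K A B x y)) =
          f a \<otimes>\<^bsub>X\<^esub> ?h (pure K A B x y) \<otimes>\<^bsub>X\<^esub> g b" if "x \<in> carrier A" "y \<in> carrier B" for x y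
        using ab that
        by (simp add: tensor_map_pure[OF AB AB l] h_pure bilinear_maps_closed[OF A.mult_bilinear]
            bilinear_maps_closed[OF B.mult_bilinear] fD gD X.m_assoc)
    qed
  qed
  have mult_pure: "?h (?m (pure K A B a b) (pure K A B a' b')) =
      ?h (pure K A B a b) \<otimes>\<^bsub>X\<^esub> ?h (pure K A B a' b')"
    if "a \<in> carrier A" "b \<in> carrier B" "a' \<in> carrier A" "b' \<in> carrier B" for a b a' b'
  proof -
    have "R (pure K B A b a') \<in> carrier ?T"
      using that by (intro linear_mapsD(1)[OF R] pure_closed AB)
    then have "?h (?m (pure K A B a b) (pure K A B a' b')) = f a \<otimes>\<^bsub>X\<^esub> (g b \<otimes>\<^bsub>X\<^esub> f a') \<otimes>\<^bsub>X\<^esub> g b'"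
      using that by (simp add: twisted_mult_map_pure[OF A B R] shift cross)
    then show ?thesis
      using that by (simp add: h_pure fD gD X.m_assoc)
  qed
  \<comment> \<open>Both sides are bilinear, and \<open>tensor_ext\<close> handles one variable at a
    time: the right argument is freed here, the left one afterwards.\<close>
  have mult_pure_left: "?h (?m (pure K A B a b) y) = ?h (pure K A B a b) \<otimes>\<^bsub>X\<^esub> ?h y"
    if "a \<in> carrier A" "b \<in> carrier B" "y \<in> carrier ?T" for a b y
  proof -
    note p = pure_closed[OF AB that(1,2)]
    show ?thesis
      by (rule tensor_ext[OF AB bilinear_mapsD(1)[OF bil1 p] bilinear_mapsD(1)[OF bil2 p]
            mult_pure[OF that(1,2)] that(3)])
  qed
  have mult: "?h (?m x y) = ?h x \<otimes>\<^bsub>X\<^esub> ?h y" if "x \<in> carrier ?T" "y \<in> carrier ?T" for x y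
    by (rule tensor_ext[OF AB bilinear_mapsD(2)[OF bil1 that(2)] bilinear_mapsD(2)[OF bil2 that(2)]
          mult_pure_left[OF _ _ that(2)] that(1)])
  show ?thesis
    using mult
    by (intro algebra_homsI)
      (simp_all add: linear_maps_twisted_tensor lin twisted_tensor_simps h_pure A.unit_closed
        B.unit_closed fD gD)
qed


section \<open>The iterated product\<close>

lemma tensor_map_R_id_linear:
  assumes "module K M" "module K N" "module K P" "module K Q" "module K B"
    and "R \<in> linear_maps K (M \<boxtimes>\<^bsub>K\<^esub> N) (P \<boxtimes>\<^bsub>K\<^esub> Q)"
  shows "tensor_map K (P \<boxtimes>\<^bsub>K\<^esub> Q) B R id \<in> linear_maps K (M \<boxtimes>\<^bsub>K\<^esub> N \<boxtimes>\<^bsub>K\<^esub> B) (P \<boxtimes>\<^bsub>K\<^esub> Q \<boxtimes>\<^bsub>K\<^esub> B)"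
  by (intro tensor_map_linear linear_maps_id assms module_tensor)

lemma unital_twisting_mapD:
  assumes "unital_twisting_map K A B R"
  shows "R \<in> linear_maps K (B \<boxtimes>\<^bsub>K\<^esub> A) (A \<boxtimes>\<^bsub>K\<^esub> B)"
    and "a \<in> carrier A \<Longrightarrow> R (pure K B A \<one>\<^bsub>B\<^esub> a) = pure K A B a \<one>\<^bsub>B\<^esub>"
    and "b \<in> carrier B \<Longrightarrow> R (pure K B A b \<one>\<^bsub>A\<^esub>) = pure K A B \<one>\<^bsub>A\<^esub> b"
  using assms by (auto simp: unital_twisting_map_def twisting_map_def)

locale iterated_twisted =
  A: assoc_algebra K A + B: assoc_algebra K B + C: assoc_algebra K C
  for K (structure) and A :: "('k, 'x, 'd) module_scheme" and B :: "('k, 'y, 'e) module_scheme"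
    and C :: "('k, 'z, 'f) module_scheme" +
  fixes R1 :: "('y \<times> 'x \<Rightarrow> 'k) set \<Rightarrow> ('x \<times> 'y \<Rightarrow> 'k) set"
    and R2 :: "('z \<times> 'y \<Rightarrow> 'k) set \<Rightarrow> ('y \<times> 'z \<Rightarrow> 'k) set"
    and R3 :: "('z \<times> 'x \<Rightarrow> 'k) set \<Rightarrow> ('x \<times> 'z \<Rightarrow> 'k) set"
  assumes R1: "unital_twisting_map K A B R1"
    and R2: "unital_twisting_map K B C R2"
    and R3: "unital_twisting_map K A C R3"
begin

abbreviation "AB \<equiv> A \<boxtimes>\<^bsub>K\<^esub> B"

abbreviation "AB' \<equiv> twisted_tensor K A B R1"

abbreviation "T1 \<equiv> iterated_twist K A B C R2 R3"

abbreviation "Z \<equiv> iterated_twisted_tensor K A B C R1 R2 R3"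

lemmas mods = A.module_axioms B.module_axioms C.module_axioms
lemmas algs = A.bilinear_algebra B.bilinear_algebra C.bilinear_algebra
lemmas R_linear = unital_twisting_mapD(1)[OF R1] unital_twisting_mapD(1)[OF R2]
  unital_twisting_mapD(1)[OF R3]
lemmas R_unital = unital_twisting_mapD(2,3)[OF R1] unital_twisting_mapD(2,3)[OF R2]
  unital_twisting_mapD(2,3)[OF R3]

lemmas R2_23_linear = tensor_map23_linear[OF mods(1,3,2,2,3) R_linear(2)]
lemmas R3_12_linear = tensor_map_R_id_linear[OF mods(3,1,1,3,2) R_linear(3)]
lemmas R2_23_pure = tensor_map23_pure[OF mods(1,3,2,2,3) R_linear(2)]
lemmas R3_12_pure = tensor_map_pure[OF module_tensor[OF mods(3,1)] mods(2) module_tensor[OF mods(1,3)]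
    mods(2) R_linear(3) linear_maps_id]
lemmas R1_23_pure = tensor_map23_pure[OF mods(3,2,1,1,2) R_linear(1)]

lemmas tensor_pure_closed = pure_closed[OF mods(1,2)] pure_closed[OF mods(1,3)] pure_closed[OF mods(2,3)]
  pure_closed[OF mods(3,1)] pure_closed[OF mods(2,1)] pure_closed[OF mods(3,2)]

lemma AB'_bilinear_algebra: "bilinear_algebra K AB'"
  by (rule twisted_tensor_bilinear_algebra[OF algs(1,2) R_linear(1)])

lemma T1_linear: "T1 \<in> linear_maps K (C \<boxtimes>\<^bsub>K\<^esub> AB') (AB' \<boxtimes>\<^bsub>K\<^esub> C)"
  unfolding iterated_twist_def comp_def tensor_twisted_tensor
  by (rule linear_maps_compose[OF linear_maps_compose[OF R2_23_linear R3_12_linear]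
        tensor_assoc_inv_linear[OF mods(3,1,2)]])

lemma T1_pure:
  assumes "c \<in> carrier C" "a \<in> carrier A" "b \<in> carrier B"
  shows "T1 (pure K C AB c (pure K A B a b)) =
    tensor_map23 K A C B B C R2 (pure K (A \<boxtimes>\<^bsub>K\<^esub> C) B (R3 (pure K C A c a)) b)"
  using assms
  by (simp add: iterated_twist_def tensor_assoc_inv_pure[OF mods(3,1,2)] R3_12_pure tensor_pure_closed)

lemma Z_bilinear_algebra: "bilinear_algebra K Z"
  unfolding iterated_twisted_tensor_def
  by (rule twisted_tensor_bilinear_algebra[OF AB'_bilinear_algebra algs(3) T1_linear])

lemma Z_carrier: "carrier Z = carrier (AB \<boxtimes>\<^bsub>K\<^esub> C)"
  by (simp add: iterated_twisted_tensor_def twisted_tensor_simps tensor_twisted_tensor)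

lemma Z_linear_maps: "linear_maps K Z M = linear_maps K (AB \<boxtimes>\<^bsub>K\<^esub> C) M"
  by (simp add: iterated_twisted_tensor_def linear_maps_twisted_tensor tensor_twisted_tensor)

lemma pure3_closed:
  "a \<in> carrier A \<Longrightarrow> b \<in> carrier B \<Longrightarrow> c \<in> carrier C \<Longrightarrow> pure3 K A B C a b c \<in> carrier Z"
  by (simp add: pure3_def Z_carrier pure_closed mods module_tensor)

lemma AB'_mult_pure:
  assumes "a \<in> carrier A" "b \<in> carrier B" "a' \<in> carrier A" "b' \<in> carrier B"
  shows "pure K A B a b \<otimes>\<^bsub>AB'\<^esub> pure K A B a' b' =
    tensor_map K A B (\<lambda>x. a \<otimes>\<^bsub>A\<^esub> x) (\<lambda>y. y \<otimes>\<^bsub>B\<^esub> b') (R1 (pure K B A b a'))"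
  by (simp add: twisted_tensor_simps twisted_mult_map_pure[OF algs(1,2) R_linear(1)] assms)

lemma Z_mult_pure:
  assumes "s \<in> carrier AB" "c \<in> carrier C" "t \<in> carrier AB" "c' \<in> carrier C"
  shows "pure K AB C s c \<otimes>\<^bsub>Z\<^esub> pure K AB C t c' =
    tensor_map K AB' C (\<lambda>x. s \<otimes>\<^bsub>AB'\<^esub> x) (\<lambda>y. y \<otimes>\<^bsub>C\<^esub> c') (T1 (pure K C AB c t))"
  using twisted_mult_map_pure[OF AB'_bilinear_algebra algs(3) T1_linear, of s c t c'] assms
  by (simp add: iterated_twisted_tensor_def twisted_tensor_simps tensor_twisted_tensor)

text \<open>In both products every twisting map has a unit as one of its arguments, so unitality
  evaluates it to a flip and only products with units remain in the factors.\<close>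

lemma pure3_eq_mult:
  assumes abc: "a \<in> carrier A" "b \<in> carrier B" "c \<in> carrier C"
  shows "pure3 K A B C a b c =
    (pure3 K A B C a \<one>\<^bsub>B\<^esub> \<one>\<^bsub>C\<^esub> \<otimes>\<^bsub>Z\<^esub> pure3 K A B C \<one>\<^bsub>A\<^esub> b \<one>\<^bsub>C\<^esub>) \<otimes>\<^bsub>Z\<^esub> pure3 K A B C \<one>\<^bsub>A\<^esub> \<one>\<^bsub>B\<^esub> c"
proof -
  note l = bilinear_mapsD(1)[OF bilinear_algebra.mult_bilinear]
    and r = bilinear_mapsD(2)[OF bilinear_algebra.mult_bilinear]
  have AB'_map: "tensor_map K A B (\<lambda>x. p \<otimes>\<^bsub>A\<^esub> x) (\<lambda>y. y \<otimes>\<^bsub>B\<^esub> q) (pure K A B x y) =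
      pure K A B (p \<otimes>\<^bsub>A\<^esub> x) (y \<otimes>\<^bsub>B\<^esub> q)"
    if "p \<in> carrier A" "q \<in> carrier B" "x \<in> carrier A" "y \<in> carrier B" for p q x y
    by (rule tensor_map_pure[OF mods(1,2) mods(1,2) l[OF algs(1) that(1)] r[OF algs(2) that(2)] that(3,4)])
  have Z_map: "tensor_map K AB' C (\<lambda>x. p \<otimes>\<^bsub>AB'\<^esub> x) (\<lambda>y. y \<otimes>\<^bsub>C\<^esub> q) (pure K AB C x y) =
      pure K AB C (p \<otimes>\<^bsub>AB'\<^esub> x) (y \<otimes>\<^bsub>C\<^esub> q)"
    if "p \<in> carrier AB" "q \<in> carrier C" "x \<in> carrier AB" "y \<in> carrier C" for p q x y
    using tensor_map_pure[OF module_twisted_tensor[OF mods(1,2)] mods(3)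
        module_twisted_tensor[OF mods(1,2)] mods(3) l[OF AB'_bilinear_algebra] r[OF algs(3)],
        of p q x y] that
    by (simp add: twisted_tensor_simps(1) tensor_twisted_tensor)
  \<comment> \<open>Tensors with first factor 1 are enough: the right-hand factors that occur have
    \<open>y = b\<close> in the first product and \<open>y\<close> the unit of \<open>B\<close> in
    the second.\<close>
  have T1_unit: "T1 (pure K C AB \<one>\<^bsub>C\<^esub> (pure K A B \<one>\<^bsub>A\<^esub> y)) = pure K AB C (pure K A B \<one>\<^bsub>A\<^esub> y) \<one>\<^bsub>C\<^esub>"
    if "y \<in> carrier B" for y
    using that by (simp add: T1_pure R_unital R2_23_pure tensor_assoc_inv_pure mods)
  have "pure3 K A B C a \<one>\<^bsub>B\<^esub> \<one>\<^bsub>C\<^esub> \<otimes>\<^bsub>Z\<^esub> pure3 K A B C \<one>\<^bsub>A\<^esub> b \<one>\<^bsub>C\<^esub> = pure3 K A B C a b \<one>\<^bsub>C\<^esub>"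
    using abc
    by (simp add: pure3_def Z_mult_pure T1_unit Z_map AB'_mult_pure R_unital AB'_map tensor_pure_closed)
  moreover have "pure3 K A B C a b \<one>\<^bsub>C\<^esub> \<otimes>\<^bsub>Z\<^esub> pure3 K A B C \<one>\<^bsub>A\<^esub> \<one>\<^bsub>B\<^esub> c = pure3 K A B C a b c"
    using abc
    by (simp add: pure3_def Z_mult_pure T1_unit Z_map AB'_mult_pure R_unital AB'_map tensor_pure_closed)
  ultimately show ?thesis by simp
qed

text \<open>Multiplicativity carries agreement on the three inclusions over to all
  \<open>pure3\<close>. Two extensions by linearity follow, because the first factor
  \<open>s\<close> of a pure tensor in \<open>AB \<boxtimes> C\<close> is itself an arbitrary
  tensor.\<close>

lemma algebra_homs_eqI:
  assumes "\<phi> \<in> algebra_homs K Z X" "\<psi> \<in> algebra_homs K Z X"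
    and "\<And>a. a \<in> carrier A \<Longrightarrow> \<phi> (pure3 K A B C a \<one>\<^bsub>B\<^esub> \<one>\<^bsub>C\<^esub>) = \<psi> (pure3 K A B C a \<one>\<^bsub>B\<^esub> \<one>\<^bsub>C\<^esub>)"
    and "\<And>b. b \<in> carrier B \<Longrightarrow> \<phi> (pure3 K A B C \<one>\<^bsub>A\<^esub> b \<one>\<^bsub>C\<^esub>) = \<psi> (pure3 K A B C \<one>\<^bsub>A\<^esub> b \<one>\<^bsub>C\<^esub>)"
    and "\<And>c. c \<in> carrier C \<Longrightarrow> \<phi> (pure3 K A B C \<one>\<^bsub>A\<^esub> \<one>\<^bsub>B\<^esub> c) = \<psi> (pure3 K A B C \<one>\<^bsub>A\<^esub> \<one>\<^bsub>B\<^esub> c)"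
    and t: "t \<in> carrier Z"
  shows "\<phi> t = \<psi> t"
proof -
  interpret Z: bilinear_algebra K Z by (rule Z_bilinear_algebra)
  note lin = algebra_homsD(1)[OF assms(1), unfolded Z_linear_maps]
    algebra_homsD(1)[OF assms(2), unfolded Z_linear_maps]
  have pure3: "\<phi> (pure3 K A B C a b c) = \<psi> (pure3 K A B C a b c)"
    if "a \<in> carrier A" "b \<in> carrier B" "c \<in> carrier C" for a b c
    unfolding pure3_eq_mult[OF that]
    using that
    by (simp add: algebra_homsD(2)[OF assms(1)] algebra_homsD(2)[OF assms(2)] assms(3-5)
        pure3_closed bilinear_maps_closed[OF Z.mult_bilinear])
  have "\<phi> (pure K AB C s c) = \<psi> (pure K AB C s c)" if s: "s \<in> carrier AB" and c: "c \<in> carrier C" for s c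
    by (rule tensor_ext[OF mods(1,2)
          linear_maps_compose[OF lin(1) bilinear_mapsD(2)[OF pure_bilinear[OF module_tensor[OF mods(1,2)] mods(3)] c]]
          linear_maps_compose[OF lin(2) bilinear_mapsD(2)[OF pure_bilinear[OF module_tensor[OF mods(1,2)] mods(3)] c]]
          _ s])
      (simp add: pure3[unfolded pure3_def] c)
  then show ?thesis
    using tensor_ext[OF module_tensor[OF mods(1,2)] mods(3) lin, of t] t by (simp add: Z_carrier)
qed

end

section \<open>Combining three algebra morphisms into \<open>X\<close>\<close>

locale iterated_twisted_homs = iterated_twisted K A B C R1 R2 R3 + X: assoc_algebra K X
  for K (structure) and A :: "('k, 'x, 'd) module_scheme" and B :: "('k, 'y, 'e) module_scheme"
    and C :: "('k, 'z, 'f) module_scheme" and R1 R2 R3 and X :: "('k, 'm, 'g) module_scheme" +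
  fixes u :: "'x \<Rightarrow> 'm" and v :: "'y \<Rightarrow> 'm" and w :: "'z \<Rightarrow> 'm"
  assumes u: "u \<in> algebra_homs K A X" and v: "v \<in> algebra_homs K B X" and w: "w \<in> algebra_homs K C X"
begin

lemmas uvw_linear = algebra_homsD(1)[OF u] algebra_homsD(1)[OF v] algebra_homsD(1)[OF w]
lemmas uvw_unit = algebra_homsD(3)[OF u] algebra_homsD(3)[OF v] algebra_homsD(3)[OF w]
lemmas uvw_closed = algebra_homsD(4)[OF u] algebra_homsD(4)[OF v] algebra_homsD(4)[OF w]

abbreviation "uv \<equiv> hom_product K X u v"
abbreviation "uw \<equiv> hom_product K X u w"
abbreviation "vw \<equiv> hom_product K X v w"
abbreviation "uvw \<equiv> hom_product K X uv w"

lemmas uv_linear = hom_product_linear[OF X.assoc_algebra_axioms mods(1,2) uvw_linear(1,2)]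
lemmas uw_linear = hom_product_linear[OF X.assoc_algebra_axioms mods(1,3) uvw_linear(1,3)]
lemmas vw_linear = hom_product_linear[OF X.assoc_algebra_axioms mods(2,3) uvw_linear(2,3)]
lemmas uvw'_linear = hom_product_linear[OF X.assoc_algebra_axioms module_tensor[OF mods(1,2)] mods(3)
    uv_linear uvw_linear(3)]

lemmas hom_products_pure =
  hom_product_pure[OF X.assoc_algebra_axioms mods(1,2) uvw_linear(1,2)]
  hom_product_pure[OF X.assoc_algebra_axioms mods(1,3) uvw_linear(1,3)]
  hom_product_pure[OF X.assoc_algebra_axioms mods(2,3) uvw_linear(2,3)]
  hom_product_pure[OF X.assoc_algebra_axioms module_tensor[OF mods(1,2)] mods(3) uv_linear uvw_linear(3)]

text \<open>On pure \<open>s\<close> this is associativity of \<open>X\<close>. The general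
  \<open>s\<close> is needed because values of \<open>R2\<close> are inserted for it.\<close>

lemma uvw_assoc_inv:
  assumes a: "a \<in> carrier A" and s: "s \<in> carrier (B \<boxtimes>\<^bsub>K\<^esub> C)"
  shows "uvw (tensor_assoc_inv K A B C (pure K A (B \<boxtimes>\<^bsub>K\<^esub> C) a s)) = u a \<otimes>\<^bsub>X\<^esub> vw s"
proof (rule tensor_ext[OF mods(2,3) _ X.linear_maps_mult_left[OF vw_linear] _ s])
  show "(\<lambda>s. uvw (tensor_assoc_inv K A B C (pure K A (B \<boxtimes>\<^bsub>K\<^esub> C) a s))) \<in> linear_maps K (B \<boxtimes>\<^bsub>K\<^esub> C) X"
    by (rule linear_maps_compose[OF linear_maps_compose[OF uvw'_linear tensor_assoc_inv_linear[OF mods]]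
          bilinear_mapsD(1)[OF pure_bilinear[OF mods(1) module_tensor[OF mods(2,3)]] a]])
  show "uvw (tensor_assoc_inv K A B C (pure K A (B \<boxtimes>\<^bsub>K\<^esub> C) a (pure K B C b c))) =
      u a \<otimes>\<^bsub>X\<^esub> vw (pure K B C b c)" if "b \<in> carrier B" "c \<in> carrier C" for b c
    using a that
    by (simp add: tensor_assoc_inv_pure[OF mods] hom_products_pure tensor_pure_closed uvw_closed X.m_assoc)
qed (use a uvw_closed in simp)

text \<open>The map \<open>T1\<close> moves \<open>C\<close> past \<open>A\<close> by
  \<open>R3\<close> and then past \<open>B\<close> by \<open>R2\<close>. In \<open>X\<close> this
  mirrors moving \<open>w c\<close> through \<open>u a \<otimes> v b\<close>, first past
  \<open>u a\<close> and then past \<open>v b\<close>.\<close>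

lemma uvw_algebra_hom:
  assumes vu: "\<And>a b. a \<in> carrier A \<Longrightarrow> b \<in> carrier B \<Longrightarrow> v b \<otimes>\<^bsub>X\<^esub> u a = uv (R1 (pure K B A b a))"
    and wv: "\<And>b c. b \<in> carrier B \<Longrightarrow> c \<in> carrier C \<Longrightarrow> w c \<otimes>\<^bsub>X\<^esub> v b = vw (R2 (pure K C B c b))"
    and wu: "\<And>a c. a \<in> carrier A \<Longrightarrow> c \<in> carrier C \<Longrightarrow> w c \<otimes>\<^bsub>X\<^esub> u a = uw (R3 (pure K C A c a))"
  shows "uvw \<in> algebra_homs K Z X"
  unfolding iterated_twisted_tensor_def
proof (rule hom_product_algebra_hom[OF AB'_bilinear_algebra algs(3) X.assoc_algebra_axioms T1_linear _ w])
  show "uv \<in> algebra_homs K AB' X"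
    by (rule hom_product_algebra_hom[OF algs(1,2) X.assoc_algebra_axioms R_linear(1) u v vu])
  \<comment> \<open>This is the second half of the move, where \<open>wv\<close> is used. The tensor
    \<open>s\<close> stands for the output of \<open>R3\<close>.\<close>
  have R2_23: "uvw (tensor_map23 K A C B B C R2 (pure K (A \<boxtimes>\<^bsub>K\<^esub> C) B s b)) = uw s \<otimes>\<^bsub>X\<^esub> v b"
    if b: "b \<in> carrier B" and s: "s \<in> carrier (A \<boxtimes>\<^bsub>K\<^esub> C)" for b s
  proof (rule tensor_ext[OF mods(1,3) _ X.linear_maps_mult_right[OF uw_linear] _ s])
    show "(\<lambda>s. uvw (tensor_map23 K A C B B C R2 (pure K (A \<boxtimes>\<^bsub>K\<^esub> C) B s b))) \<in> linear_maps K (A \<boxtimes>\<^bsub>K\<^esub> C) X"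
      by (rule linear_maps_compose[OF linear_maps_compose[OF uvw'_linear R2_23_linear]
            bilinear_mapsD(2)[OF pure_bilinear[OF module_tensor[OF mods(1,3)] mods(2)] b]])
    show "uvw (tensor_map23 K A C B B C R2 (pure K (A \<boxtimes>\<^bsub>K\<^esub> C) B (pure K A C a c) b)) =
        uw (pure K A C a c) \<otimes>\<^bsub>X\<^esub> v b" if "a \<in> carrier A" "c \<in> carrier C" for a c
      using b that
      by (simp add: R2_23_pure uvw_assoc_inv hom_products_pure wv[symmetric] X.m_assoc uvw_closed
          linear_mapsD(1)[OF R_linear(2)] tensor_pure_closed)
  qed (use b uvw_closed in simp)
  show "w c \<otimes>\<^bsub>X\<^esub> uv t = uvw (T1 (pure K C AB' c t))" if t: "t \<in> carrier AB'" and c: "c \<in> carrier C" for t c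
    unfolding tensor_twisted_tensor
  proof (rule tensor_ext[OF mods(1,2) X.linear_maps_mult_left[OF uv_linear] _ _ t[unfolded twisted_tensor_simps]])
    show "(\<lambda>t. uvw (T1 (pure K C AB c t))) \<in> linear_maps K AB X"
      by (rule linear_maps_compose[OF linear_maps_compose[OF uvw'_linear
              T1_linear[unfolded tensor_twisted_tensor]]
            bilinear_mapsD(1)[OF pure_bilinear[OF mods(3) module_tensor[OF mods(1,2)]] c]])
    show "w c \<otimes>\<^bsub>X\<^esub> uv (pure K A B a b) = uvw (T1 (pure K C AB c (pure K A B a b)))"
      if "a \<in> carrier A" "b \<in> carrier B" for a b
      using c that
      by (simp add: T1_pure R2_23 linear_mapsD(1)[OF R_linear(3)] tensor_pure_closed hom_products_pure
          wu[symmetric] X.m_assoc uvw_closed)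
  qed (use c uvw_closed in simp)
qed

lemma uvw_pure3:
  assumes "a \<in> carrier A" "b \<in> carrier B" "c \<in> carrier C"
  shows "uvw (pure3 K A B C a b c) = u a \<otimes>\<^bsub>X\<^esub> v b \<otimes>\<^bsub>X\<^esub> w c"
  using assms by (simp add: pure3_def hom_products_pure tensor_pure_closed)

end

text \<open>Stated for arbitrary \<open>A\<close>, \<open>B\<close>, \<open>C\<close> because it
  serves both sides of the hypothesis: \<open>w\<close>, \<open>v\<close>, \<open>u\<close> on the
  reversed triple product and \<open>u\<close>, \<open>v\<close>, \<open>w\<close> on the original
  one.\<close>

lemma mult_map3_tensor_map3_pure:
  assumes X: "assoc_algebra K X" and mods: "module K A" "module K B" "module K C"
    and lin: "u \<in> linear_maps K A X" "v \<in> linear_maps K B X" "w \<in> linear_maps K C X"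
    and "a \<in> carrier A" "b \<in> carrier B" "c \<in> carrier C"
  shows "mult_map3 K X (tensor_map3 K X u v w (pure K (A \<boxtimes>\<^bsub>K\<^esub> B) C (pure K A B a b) c)) =
    u a \<otimes>\<^bsub>X\<^esub> v b \<otimes>\<^bsub>X\<^esub> w c"
proof -
  interpret X: assoc_algebra K X by (rule X)
  interpret Xb: bilinear_algebra K X by (rule X.bilinear_algebra)
  show ?thesis
    using assms
    by (simp add: mult_map3_def tensor_map3_def module_tensor pure_closed X.module_axioms
        tensor_map_pure[OF _ _ _ _ tensor_map_linear[OF _ _ _ _ lin(1,2)] lin(3)]
        tensor_map_pure[OF _ _ _ _ lin(1,2)] tensor_map_pure[OF _ _ _ _ Xb.mult_map_linear linear_maps_id]
        Xb.mult_map_pure linear_mapsD(1)[OF lin(1)] linear_mapsD(1)[OF lin(2)] linear_mapsD(1)[OF lin(3)])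
qed

lemma mult_map3_tensor_map3_linear:
  assumes X: "assoc_algebra K X" and mods: "module K A" "module K B" "module K C"
    and lin: "u \<in> linear_maps K A X" "v \<in> linear_maps K B X" "w \<in> linear_maps K C X"
  shows "(\<lambda>t. mult_map3 K X (tensor_map3 K X u v w t)) \<in> linear_maps K (A \<boxtimes>\<^bsub>K\<^esub> B \<boxtimes>\<^bsub>K\<^esub> C) X"
proof -
  interpret X: assoc_algebra K X by (rule X)
  interpret Xb: bilinear_algebra K X by (rule X.bilinear_algebra)
  have XX: "module K X" "module K (X \<boxtimes>\<^bsub>K\<^esub> X)" by (intro X.module_axioms module_tensor)+
  show ?thesis
    unfolding mult_map3_def tensor_map3_def comp_def
    by (rule linear_maps_compose[OF linear_maps_compose[OF Xb.mult_map_linear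
            tensor_map_linear[OF XX(2,1,1,1) Xb.mult_map_linear linear_maps_id]]
          tensor_map_linear[OF module_tensor[OF mods(1,2)] mods(3) XX(2,1)
            tensor_map_linear[OF mods(1,2) XX(1,1) lin(1,2)] lin(3)]])
qed

section \<open>Pairwise crossing relations from the hypothesis on \<open>u\<close>,
  \<open>v\<close>, \<open>w\<close>\<close>

context iterated_twisted_homs
begin

text \<open>Translates the threefold product in the hypothesis into the iterated
  \<open>hom_product\<close> from which the morphism is built.\<close>

lemma uvw_eq_mult_map3:
  assumes "t \<in> carrier (AB \<boxtimes>\<^bsub>K\<^esub> C)"
  shows "mult_map3 K X (tensor_map3 K X u v w t) = uvw t"
proof (rule tensor_ext[OF module_tensor[OF mods(1,2)] mods(3)
      mult_map3_tensor_map3_linear[OF X.assoc_algebra_axioms mods uvw_linear] uvw'_linear _ assms])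
  show "mult_map3 K X (tensor_map3 K X u v w (pure K AB C s c)) = uvw (pure K AB C s c)"
    if s: "s \<in> carrier AB" and c: "c \<in> carrier C" for s c
  proof -
    note pure_linear = bilinear_mapsD(2)[OF pure_bilinear[OF module_tensor[OF mods(1,2)] mods(3)] c]
    show ?thesis
    proof (rule tensor_ext[OF mods(1,2)
          linear_maps_compose[OF mult_map3_tensor_map3_linear[OF X.assoc_algebra_axioms mods uvw_linear] pure_linear]
          linear_maps_compose[OF uvw'_linear pure_linear] _ s])
    show "mult_map3 K X (tensor_map3 K X u v w (pure K AB C (pure K A B a b) c)) =
        uvw (pure K AB C (pure K A B a b) c)" if "a \<in> carrier A" "b \<in> carrier B" for a b
      using that c
      by (simp add: mult_map3_tensor_map3_pure[OF X.assoc_algebra_axioms mods uvw_linear]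
          hom_products_pure tensor_pure_closed)
    qed
  qed
qed

context
  assumes cross: "\<forall>t\<in>carrier (C \<boxtimes>\<^bsub>K\<^esub> B \<boxtimes>\<^bsub>K\<^esub> A).
      (mult_map3 K X \<circ> tensor_map3 K X w v u) t =
      (mult_map3 K X \<circ> tensor_map3 K X u v w \<circ>
        tensor_map23 K A C B B C R2 \<circ> tensor_map K (A \<boxtimes>\<^bsub>K\<^esub> C) B R3 id \<circ>
        tensor_map23 K C B A A B R1) t"
begin

text \<open>The hypothesis on a pure tensor, evaluated up to \<open>R1\<close>. Its value is not
  pure in general, so the remaining maps are left unevaluated until a unit is inserted.\<close>

lemma cross_pure:
  assumes "a \<in> carrier A" "b \<in> carrier B" "c \<in> carrier C"
  shows "w c \<otimes>\<^bsub>X\<^esub> v b \<otimes>\<^bsub>X\<^esub> u a =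
    uvw (tensor_map23 K A C B B C R2 (tensor_map K (A \<boxtimes>\<^bsub>K\<^esub> C) B R3 id
      (tensor_assoc_inv K C A B (pure K C AB c (R1 (pure K B A b a))))))"
proof -
  let ?t = "pure K (C \<boxtimes>\<^bsub>K\<^esub> B) A (pure K C B c b) a"
  let ?s = "tensor_map23 K C B A A B R1 ?t"
  have t: "?t \<in> carrier (C \<boxtimes>\<^bsub>K\<^esub> B \<boxtimes>\<^bsub>K\<^esub> A)"
    using assms by (intro pure_closed module_tensor mods)
  have s: "?s \<in> carrier (C \<boxtimes>\<^bsub>K\<^esub> A \<boxtimes>\<^bsub>K\<^esub> B)"
    by (rule linear_mapsD(1)[OF tensor_map23_linear[OF mods(3,2,1,1,2) R_linear(1)] t])
  have "tensor_map23 K A C B B C R2 (tensor_map K (A \<boxtimes>\<^bsub>K\<^esub> C) B R3 id ?s) \<in> carrier (AB \<boxtimes>\<^bsub>K\<^esub> C)"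
    by (rule linear_mapsD(1)[OF R2_23_linear linear_mapsD(1)[OF R3_12_linear s]])
  then show ?thesis
    using bspec[OF cross t] assms
    by (simp add: mult_map3_tensor_map3_pure[OF X.assoc_algebra_axioms mods(3,2,1) uvw_linear(3,2,1)]
        uvw_eq_mult_map3 R1_23_pure)
qed

text \<open>Put \<open>c = 1\<close>. What follows \<open>R1\<close> is then the map
  \<open>?f\<close>, in which \<open>R3\<close> and \<open>R2\<close> only carry the unit of
  \<open>C\<close> to the right, where \<open>w\<close> turns it into 1. Hence \<open>?f\<close>
  equals \<open>uv\<close>.\<close>

lemma cross_vu:
  assumes ab: "a \<in> carrier A" "b \<in> carrier B"
  shows "v b \<otimes>\<^bsub>X\<^esub> u a = uv (R1 (pure K B A b a))"
proof -
  let ?f = "\<lambda>t. uvw (tensor_map23 K A C B B C R2 (tensor_map K (A \<boxtimes>\<^bsub>K\<^esub> C) B R3 id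
      (tensor_assoc_inv K C A B (pure K C AB \<one>\<^bsub>C\<^esub> t))))"
  have "?f t = uv t" if t: "t \<in> carrier AB" for t
  proof (rule tensor_ext[OF mods(1,2) _ uv_linear _ t])
    show "?f \<in> linear_maps K AB X"
      by (rule linear_maps_compose[OF linear_maps_compose[OF linear_maps_compose[OF linear_maps_compose[OF
                  uvw'_linear R2_23_linear] R3_12_linear] tensor_assoc_inv_linear[OF mods(3,1,2)]]
            bilinear_mapsD(1)[OF pure_bilinear[OF mods(3) module_tensor[OF mods(1,2)]] C.one_closed]])
    show "?f (pure K A B x y) = uv (pure K A B x y)" if "x \<in> carrier A" "y \<in> carrier B" for x y
      using that
      by (simp add: tensor_assoc_inv_pure[OF mods(3,1,2)] R3_12_pure tensor_pure_closed R_unital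
          R2_23_pure tensor_assoc_inv_pure[OF mods] hom_products_pure uvw_unit uvw_closed)
  qed
  then show ?thesis
    using cross_pure[OF ab C.one_closed] ab
    by (simp add: uvw_unit uvw_closed linear_mapsD(1)[OF R_linear(1)] tensor_pure_closed)
qed

text \<open>Put \<open>a = 1\<close>. Then \<open>R1\<close> and \<open>R3\<close> return pure
  tensors and can be evaluated at once. The map left over, \<open>R2\<close>, is applied last, and
  \<open>uvw_assoc_inv\<close> covers its arbitrary value.\<close>

lemma cross_wv:
  assumes bc: "b \<in> carrier B" "c \<in> carrier C"
  shows "w c \<otimes>\<^bsub>X\<^esub> v b = vw (R2 (pure K C B c b))"
  using cross_pure[OF A.one_closed bc] bc
  by (simp add: R_unital tensor_assoc_inv_pure[OF mods(3,1,2)] R3_12_pure tensor_pure_closed R2_23_pure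
      uvw_assoc_inv linear_mapsD(1)[OF R_linear(2)] uvw_unit uvw_closed
      linear_mapsD(1)[OF vw_linear])

text \<open>Put \<open>b = 1\<close>. Then \<open>R1\<close> is a flip, and \<open>R3\<close> yields
  an arbitrary tensor \<open>t\<close> next to the unit of \<open>B\<close>. On pure
  \<open>t\<close> the map \<open>R2\<close> moves that unit back to the middle, where
  \<open>v\<close> turns it into 1.\<close>

lemma cross_wu:
  assumes ac: "a \<in> carrier A" "c \<in> carrier C"
  shows "w c \<otimes>\<^bsub>X\<^esub> u a = uw (R3 (pure K C A c a))"
proof -
  let ?f = "\<lambda>t. uvw (tensor_map23 K A C B B C R2 (pure K (A \<boxtimes>\<^bsub>K\<^esub> C) B t \<one>\<^bsub>B\<^esub>))"
  have "?f t = uw t" if t: "t \<in> carrier (A \<boxtimes>\<^bsub>K\<^esub> C)" for t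
  proof (rule tensor_ext[OF mods(1,3) _ uw_linear _ t])
    show "?f \<in> linear_maps K (A \<boxtimes>\<^bsub>K\<^esub> C) X"
      by (rule linear_maps_compose[OF linear_maps_compose[OF uvw'_linear R2_23_linear]
            bilinear_mapsD(2)[OF pure_bilinear[OF module_tensor[OF mods(1,3)] mods(2)] B.one_closed]])
    show "?f (pure K A C x z) = uw (pure K A C x z)" if "x \<in> carrier A" "z \<in> carrier C" for x z
      using that
      by (simp add: R_unital R2_23_pure uvw_assoc_inv tensor_pure_closed hom_products_pure uvw_unit
          uvw_closed)
  qed
  then show ?thesis
    using cross_pure[OF ac(1) B.one_closed ac(2)] ac
    by (simp add: uvw_unit uvw_closed R_unital tensor_assoc_inv_pure[OF mods(3,1,2)] R3_12_pure
        linear_mapsD(1)[OF R_linear(3)] tensor_pure_closed)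
qed

lemma ex1_algebra_hom:
  "\<exists>!\<phi>. \<phi> \<in> algebra_homs K Z X \<and> \<phi> \<in> extensional (carrier Z)
      \<and> (\<forall>a\<in>carrier A. \<phi> (pure3 K A B C a \<one>\<^bsub>B\<^esub> \<one>\<^bsub>C\<^esub>) = u a)
      \<and> (\<forall>b\<in>carrier B. \<phi> (pure3 K A B C \<one>\<^bsub>A\<^esub> b \<one>\<^bsub>C\<^esub>) = v b)
      \<and> (\<forall>c\<in>carrier C. \<phi> (pure3 K A B C \<one>\<^bsub>A\<^esub> \<one>\<^bsub>B\<^esub> c) = w c)"
proof -
  \<comment> \<open>Restriction changes nothing on \<open>carrier Z\<close> and makes the map
    \<open>extensional\<close>, so that a competitor agreeing with it there is equal to it as a
    function.\<close>
  let ?\<phi> = "restrict uvw (carrier Z)"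
  have hom: "?\<phi> \<in> algebra_homs K Z X"
    by (rule bilinear_algebra.algebra_homs_restrict[OF Z_bilinear_algebra
          uvw_algebra_hom[OF cross_vu cross_wv cross_wu]])
  have \<phi>_A: "?\<phi> (pure3 K A B C a \<one>\<^bsub>B\<^esub> \<one>\<^bsub>C\<^esub>) = u a" if "a \<in> carrier A" for a
    using that by (simp add: pure3_closed uvw_pure3 uvw_unit uvw_closed)
  have \<phi>_B: "?\<phi> (pure3 K A B C \<one>\<^bsub>A\<^esub> b \<one>\<^bsub>C\<^esub>) = v b" if "b \<in> carrier B" for b
    using that by (simp add: pure3_closed uvw_pure3 uvw_unit uvw_closed)
  have \<phi>_C: "?\<phi> (pure3 K A B C \<one>\<^bsub>A\<^esub> \<one>\<^bsub>B\<^esub> c) = w c" if "c \<in> carrier C" for c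
    using that by (simp add: pure3_closed uvw_pure3 uvw_unit uvw_closed)
  show ?thesis
  proof (rule ex1I, intro conjI ballI)
    fix \<psi>
    assume \<psi>: "\<psi> \<in> algebra_homs K Z X \<and> \<psi> \<in> extensional (carrier Z)
      \<and> (\<forall>a\<in>carrier A. \<psi> (pure3 K A B C a \<one>\<^bsub>B\<^esub> \<one>\<^bsub>C\<^esub>) = u a)
      \<and> (\<forall>b\<in>carrier B. \<psi> (pure3 K A B C \<one>\<^bsub>A\<^esub> b \<one>\<^bsub>C\<^esub>) = v b)
      \<and> (\<forall>c\<in>carrier C. \<psi> (pure3 K A B C \<one>\<^bsub>A\<^esub> \<one>\<^bsub>B\<^esub> c) = w c)"
    have "\<psi> t = ?\<phi> t" if "t \<in> carrier Z" for t
    proof (rule algebra_homs_eqI[OF _ hom _ _ _ that])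
      show "\<psi> \<in> algebra_homs K Z X" using \<psi> by (rule conjunct1)
    qed (simp_all only: \<psi> \<phi>_A \<phi>_B \<phi>_C)
    with \<psi> show "\<psi> = ?\<phi>"
      by (intro extensionalityI[of \<psi> "carrier Z"] restrict_extensional) simp_all
  qed (simp_all only: hom \<phi>_A \<phi>_B \<phi>_C restrict_extensional)
qed

end

end

theorem theorem2p7:
  fixes K :: "('k, 'c) ring_scheme"
    and A :: "('k, 'x, 'd) module_scheme"
    and B :: "('k, 'y, 'e) module_scheme"
    and C :: "('k, 'z, 'f) module_scheme"
    and X :: "('k, 'm, 'g) module_scheme"
    and R1 :: "('y \<times> 'x \<Rightarrow> 'k) set \<Rightarrow> ('x \<times> 'y \<Rightarrow> 'k) set"
    and R2 :: "('z \<times> 'y \<Rightarrow> 'k) set \<Rightarrow> ('y \<times> 'z \<Rightarrow> 'k) set"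
    and R3 :: "('z \<times> 'x \<Rightarrow> 'k) set \<Rightarrow> ('x \<times> 'z \<Rightarrow> 'k) set"
    and u :: "'x \<Rightarrow> 'm" and v :: "'y \<Rightarrow> 'm" and w :: "'z \<Rightarrow> 'm"
  assumes "cring K"
    and "assoc_algebra K A" and "assoc_algebra K B" and "assoc_algebra K C"
    and "unital_twisting_map K A B R1"
    and "unital_twisting_map K B C R2"
    and "unital_twisting_map K A C R3"
    and "hexagon K A B C R1 R2 R3"
    and "assoc_algebra K X"
    and "u \<in> algebra_homs K A X" and "v \<in> algebra_homs K B X" and "w \<in> algebra_homs K C X"
    and "\<forall>t\<in>carrier (C \<boxtimes>\<^bsub>K\<^esub> B \<boxtimes>\<^bsub>K\<^esub> A).
      (mult_map3 K X \<circ> tensor_map3 K X w v u) t =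
      (mult_map3 K X \<circ> tensor_map3 K X u v w \<circ>
        tensor_map23 K A C B B C R2 \<circ> tensor_map K (A \<boxtimes>\<^bsub>K\<^esub> C) B R3 id \<circ>
        tensor_map23 K C B A A B R1) t"
  shows "\<exists>!\<phi>. \<phi> \<in> algebra_homs K (iterated_twisted_tensor K A B C R1 R2 R3) X
      \<and> \<phi> \<in> extensional (carrier (iterated_twisted_tensor K A B C R1 R2 R3))
      \<and> (\<forall>a\<in>carrier A. \<phi> (pure3 K A B C a \<one>\<^bsub>B\<^esub> \<one>\<^bsub>C\<^esub>) = u a)
      \<and> (\<forall>b\<in>carrier B. \<phi> (pure3 K A B C \<one>\<^bsub>A\<^esub> b \<one>\<^bsub>C\<^esub>) = v b)
      \<and> (\<forall>c\<in>carrier C. \<phi> (pure3 K A B C \<one>\<^bsub>A\<^esub> \<one>\<^bsub>B\<^esub> c) = w c)"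
proof -
  interpret iterated_twisted_homs K A B C R1 R2 R3 X u v w
    by (intro iterated_twisted_homs.intro iterated_twisted.intro iterated_twisted_axioms.intro
        iterated_twisted_homs_axioms.intro assms)
  \<comment> \<open>\<open>assms(13)\<close> is the compatibility of \<open>u\<close>,
    \<open>v\<close>, \<open>w\<close> with the twisting maps, the premise under which the crossing
    relations were derived.\<close>
  show ?thesis by (rule ex1_algebra_hom) (rule assms(13))
qed

end
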